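(* Let $p$ be a prime, $n\ge1$, $F$ a field with $\xi_p\in F$, and $K/F$ cyclic Galois of degree $p^n$; if $p=2$ assume $n>1$ or $-1\in N_{K/F}(K^\times)$. Then, with $s$ ranging over $\mathcal{E}=\{-\infty,0,1,\dots,n-1\}$, \[\begin{aligned} i(K/F)&=\min\{s:\ \xi_p\in N_{K/F}(K^\times)\,N_{K_{n-1}/F}(K_s^\times)\}\\ &=\min\{s:\ \xi_p\in N_{K/K_{s\dotplus1}}(K^\times)\}\\ &=\min\{s:\ \exists[\delta]\in J^{H_{s\dotplus1}}\text{ with } [N_{K/K_{s\dotplus1}}(\delta)]_{K_{s\dotplus1}}\ne[1]_{K_{s\dotplus1}}\}.\end{aligned}\]
   Context: $K_i$ is the intermediate field with $[K_i:F]=p^i$, $H_i=\mathrm{Gal}(K/K_i)$, $G=\mathrm{Gal}(K/F)$; $K_{-\infty}^\times=\{1\}$ and $N_{K_{n-1}/F}(K_{-\infty}^\times)=\{1\}$; $-\infty\dotplus1=0$ and $e\dotplus1=e+1$ for $e\ge0$. $J=K^\times/K^{\times p}$, $[\delta]$ the class of $\delta$, $[A]$ the image of a subgroup $A\subset K^\times$ in $J$, and for a field $E$, $[e]_E$ the class of $e$ in $E^\times/E^{\times p}$. $\xi_p$ is a primitive $p$-th root of unity. $i(K/F)=\min\{i\in\{-\infty,0,\dots,n\}:\exists\delta\in K^\times$ with $[N_{K/F}(\delta)]_F\ne[1]_F$ and $[\delta]^{\tau-1}\in[K_i^\times]$ for all $\tau\in G\}$. *)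

theory Defs
  imports "HOL-Algebra.Algebra" "HOL-Library.Option_ord"
begin

text \<open>
  Fields are records as in HOL-Algebra. In a tower \<open>E \<subseteq> L\<close> the upper field \<open>L\<close> is a record and
  the lower field \<open>E\<close> is the carrier of a subfield; a subfield \<open>E\<close> of \<open>L\<close> becomes a record again
  as \<open>L\<lparr>carrier := E\<rparr>\<close>.
\<close>

text \<open>As in \<^const>\<open>BijGroup\<close>, automorphisms are extensional functions on the carrier.\<close>

definition Gal :: "('a, 'b) ring_scheme \<Rightarrow> 'a set \<Rightarrow> ('a \<Rightarrow> 'a) monoid" where
  "Gal L E = BijGroup (carrier L)
     \<lparr>carrier := {\<sigma> \<in> ring_hom L L \<inter> Bij (carrier L). \<forall>x\<in>E. \<sigma> x = x}\<rparr>"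

definition galois_extension :: "('a, 'b) ring_scheme \<Rightarrow> 'a set \<Rightarrow> bool" where
  "galois_extension L E \<longleftrightarrow>
     field L \<and> subfield E L \<and> ring.finite_dimension L E (carrier L) \<and>
     {x \<in> carrier L. \<forall>\<sigma>\<in>carrier (Gal L E). \<sigma> x = x} = E"

definition cyclic_extension :: "('a, 'b) ring_scheme \<Rightarrow> 'a set \<Rightarrow> nat \<Rightarrow> bool" where
  "cyclic_extension L E d \<longleftrightarrow>
     galois_extension L E \<and> cyclic_group (Gal L E) \<and> ring.dimension L d E (carrier L)"

text \<open>The norm of a Galois extension: the product of all conjugates.\<close>

definition field_norm :: "('a, 'b) ring_scheme \<Rightarrow> 'a set \<Rightarrow> 'a \<Rightarrow> 'a" where
  "field_norm L E x = finprod L (\<lambda>\<sigma>. \<sigma> x) (carrier (Gal L E))"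

definition nonzero :: "('a, 'b) ring_scheme \<Rightarrow> 'a set" where
  "nonzero L = carrier (Multiplicative_Group.mult_of L)"

definition pth_powers :: "('a, 'b) ring_scheme \<Rightarrow> nat \<Rightarrow> 'a set" where
  "pth_powers L p = (\<lambda>x. x [^]\<^bsub>L\<^esub> p) ` nonzero L"

definition pth_classes :: "('a, 'b) ring_scheme \<Rightarrow> nat \<Rightarrow> 'a set monoid" where
  "pth_classes L p = Multiplicative_Group.mult_of L Mod pth_powers L p"

definition pth_class :: "('a, 'b) ring_scheme \<Rightarrow> nat \<Rightarrow> 'a \<Rightarrow> 'a set" where
  "pth_class L p x = pth_powers L p #>\<^bsub>Multiplicative_Group.mult_of L\<^esub> x"

text \<open>
  An automorphism \<open>\<tau>\<close> preserves the subgroup of \<open>p\<close>-th powers, so it maps the class of \<open>\<delta>\<close>,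
  a coset, onto the class of \<open>\<tau> \<delta>\<close>: the Galois action on classes is the image \<open>\<tau> ` c\<close>.
\<close>

definition fixed_classes :: "('a, 'b) ring_scheme \<Rightarrow> nat \<Rightarrow> ('a \<Rightarrow> 'a) monoid \<Rightarrow> 'a set set" where
  "fixed_classes L p H = {c \<in> carrier (pth_classes L p). \<forall>\<tau>\<in>carrier H. \<tau> ` c = c}"

text \<open>The class \<open>c\<close> raised to \<open>\<tau> - 1\<close>, an element of the integral group ring.\<close>

definition class_tau_minus_one :: "('a, 'b) ring_scheme \<Rightarrow> nat \<Rightarrow> ('a \<Rightarrow> 'a) \<Rightarrow> 'a set \<Rightarrow> 'a set" where
  "class_tau_minus_one L p \<tau> c = (\<tau> ` c) \<otimes>\<^bsub>pth_classes L p\<^esub> inv\<^bsub>pth_classes L p\<^esub> c"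

text \<open>The intermediate field \<open>K\<^sub>i\<close>; it exists and is unique if \<open>K\<close> is cyclic of degree \<open>p ^ n\<close>
  over \<open>F\<close> and \<open>i \<le> n\<close>.\<close>

definition interm :: "('a, 'b) ring_scheme \<Rightarrow> 'a set \<Rightarrow> nat \<Rightarrow> nat \<Rightarrow> 'a set" where
  "interm K F p i = (THE L. subfield L K \<and> F \<subseteq> L \<and> ring.dimension K (p ^ i) F L)"

abbreviation interm_field ::
    "('a, 'b) ring_scheme \<Rightarrow> 'a set \<Rightarrow> nat \<Rightarrow> nat \<Rightarrow> ('a, 'b) ring_scheme" where
  "interm_field K F p i \<equiv> K\<lparr>carrier := interm K F p i\<rparr>"

text \<open>
  Indices in \<open>{-\<infinity>, 0, 1, \<dots>}\<close> are of type \<^typ>\<open>nat option\<close>, with \<^const>\<open>None\<close> in the role of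
  \<open>-\<infinity>\<close>: it is the least element of the order of \<^theory>\<open>HOL-Library.Option_ord\<close>.
\<close>

definition indices_below :: "nat \<Rightarrow> nat option set" where
  "indices_below m = insert None (Some ` {..<m})"

fun dot_succ :: "nat option \<Rightarrow> nat" where
  "dot_succ None = 0"
| "dot_succ (Some e) = e + 1"

fun interm_units :: "('a, 'b) ring_scheme \<Rightarrow> 'a set \<Rightarrow> nat \<Rightarrow> nat option \<Rightarrow> 'a set" where
  "interm_units K F p None = {\<one>\<^bsub>K\<^esub>}"
| "interm_units K F p (Some i) = nonzero (interm_field K F p i)"

text \<open>The range is \<open>{-\<infinity>, 0, \<dots>, n}\<close>, one more index than in the theorem.\<close>

definition i_candidates :: "('a, 'b) ring_scheme \<Rightarrow> 'a set \<Rightarrow> nat \<Rightarrow> nat \<Rightarrow> nat option set" where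
  "i_candidates K F p n = {i \<in> indices_below (n + 1). \<exists>\<delta>\<in>nonzero K.
     pth_class (K\<lparr>carrier := F\<rparr>) p (field_norm K F \<delta>) \<noteq> pth_class (K\<lparr>carrier := F\<rparr>) p \<one>\<^bsub>K\<^esub> \<and>
     (\<forall>\<tau>\<in>carrier (Gal K F).
        class_tau_minus_one K p \<tau> (pth_class K p \<delta>) \<in> pth_class K p ` interm_units K F p i)}"

definition i_inv :: "('a, 'b) ring_scheme \<Rightarrow> 'a set \<Rightarrow> nat \<Rightarrow> nat \<Rightarrow> nat option" where
  "i_inv K F p n = Min (i_candidates K F p n)"

end

theory Submission
  imports Defs
begin

text \<open>
  Write \<open>\<sigma>\<close> for a generator of the Galois group, so that \<open>K\<^sub>i\<close> is the fixed field of \<open>\<sigma>\<close> iterated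
  \<open>p\<^sup>i\<close> times. Once Hilbert 90 is known for every \<open>K / K\<^sub>i\<close>, only the multiplicative group of \<open>K\<close> with
  the action of \<open>\<sigma>\<close> matters.

  If \<open>\<sigma> \<delta> / \<delta> = y k\<^sup>p\<close> with \<open>y \<in> K\<^sub>n\<^sub>-\<^sub>1\<close>, then the norm of \<open>\<delta>\<close> has an explicit \<open>p\<close>-th root \<open>x\<close>, and
  \<open>\<sigma> x / x\<close> is the norm of \<open>y\<close> from \<open>K\<^sub>n\<^sub>-\<^sub>1\<close> times the norm of \<open>k\<close> from \<open>K\<close>, which is a \<open>p\<close>-th root of
  unity. The norm of \<open>\<delta>\<close> is a \<open>p\<close>-th power in \<open>F\<close> iff this root of unity is trivial; with Hilbert 90
  this identifies \<open>i(K/F)\<close> with the first minimum and, for \<open>y = 1\<close> and \<open>K\<^sub>i\<close> in place of \<open>F\<close>, the third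
  minimum with the second. The first two agree by explicit versions of the restriction and inflation
  arguments for the cyclic algebra of \<open>\<xi>\<close>.

  For \<open>p = 2\<close> and \<open>n = 1\<close> the formula for the root fails unless \<open>y = 1\<close>, but then \<open>\<xi> = -1\<close> is a norm by
  assumption and all minima are \<open>-\<infinity>\<close>.
\<close>

section \<open>The norm of a cyclic action on an abelian group\<close>

text \<open>The group ring element \<open>1 + \<sigma> + ... + \<sigma>^(m-1)\<close> acting on
  \<open>x\<close>; it is the norm once \<open>\<sigma> ^^ m\<close> is trivial. Shorter lengths
  give the partial norms of the telescoping identities and of Hilbert 90.\<close>

primrec orbit_prod :: "('a, 'b) monoid_scheme \<Rightarrow> ('a \<Rightarrow> 'a) \<Rightarrow> nat \<Rightarrow> 'a \<Rightarrow> 'a" where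
  "orbit_prod G \<sigma> 0 x = \<one>\<^bsub>G\<^esub>"
| "orbit_prod G \<sigma> (Suc m) x = orbit_prod G \<sigma> m x \<otimes>\<^bsub>G\<^esub> (\<sigma> ^^ m) x"

text \<open>An operator of the type of Kolyvagin's derivative: applying \<open>\<sigma> - 1\<close>
  to it yields the norm minus \<open>m\<close>, see \<open>endo_S\<close>.\<close>

primrec iterated_orbit_prod :: "('a, 'b) monoid_scheme \<Rightarrow> ('a \<Rightarrow> 'a) \<Rightarrow> nat \<Rightarrow> 'a \<Rightarrow> 'a" where
  "iterated_orbit_prod G \<sigma> 0 x = \<one>\<^bsub>G\<^esub>"
| "iterated_orbit_prod G \<sigma> (Suc m) x = iterated_orbit_prod G \<sigma> m x \<otimes>\<^bsub>G\<^esub> orbit_prod G \<sigma> m x"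

locale comm_group_endo = comm_group G for G (structure) +
  fixes \<sigma> :: "'a \<Rightarrow> 'a"
  assumes endo: "\<sigma> \<in> hom G G"
begin

abbreviation N where "N \<equiv> orbit_prod G \<sigma>"
abbreviation S where "S \<equiv> iterated_orbit_prod G \<sigma>"

lemma endo_closed [simp]: "x \<in> carrier G \<Longrightarrow> \<sigma> x \<in> carrier G"
  using endo by (auto simp: hom_def)

lemma endo_mult [simp]: "x \<in> carrier G \<Longrightarrow> y \<in> carrier G \<Longrightarrow> \<sigma> (x \<otimes> y) = \<sigma> x \<otimes> \<sigma> y"
  using endo by (auto simp: hom_def)

lemma endo_one [simp]: "\<sigma> \<one> = \<one>"
  using endo hom_one group_axioms by blast

lemma endo_pow [simp]: "x \<in> carrier G \<Longrightarrow> \<sigma> (x [^] (k::nat)) = \<sigma> x [^] k"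
  by (induction k) simp_all

lemma endo_inv [simp]: "x \<in> carrier G \<Longrightarrow> \<sigma> (inv x) = inv (\<sigma> x)"
  by (metis endo_closed endo_mult endo_one inv_closed inv_equality l_inv)

lemma funpow_endo: "comm_group_endo G (\<sigma> ^^ j)"
proof
  show "\<sigma> ^^ j \<in> hom G G"
    by (induction j) (auto simp: hom_def Pi_iff)
qed

lemma quotient_cancel:
  assumes "x \<in> carrier G" "y \<in> carrier G" shows "y = x \<otimes> (y \<otimes> inv x)"
  using assms by (simp add: m_lcomm[of x])

lemma N_closed [simp]: "x \<in> carrier G \<Longrightarrow> N m x \<in> carrier G"
proof (induction m)
  case (Suc m)
  interpret \<tau>: comm_group_endo G "\<sigma> ^^ m" by (rule funpow_endo)
  show ?case using Suc by simp
qed simp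

lemma S_closed [simp]: "x \<in> carrier G \<Longrightarrow> S m x \<in> carrier G"
  by (induction m) simp_all

lemma funpow_closed [simp]: "x \<in> carrier G \<Longrightarrow> (\<sigma> ^^ j) x \<in> carrier G"
  by (meson comm_group_endo.endo_closed funpow_endo)

lemma funpow_endo_mult [simp]:
  "x \<in> carrier G \<Longrightarrow> y \<in> carrier G \<Longrightarrow> (\<sigma> ^^ j) (x \<otimes> y) = (\<sigma> ^^ j) x \<otimes> (\<sigma> ^^ j) y"
  by (meson comm_group_endo.endo_mult funpow_endo)

lemma funpow_one [simp]: "(\<sigma> ^^ j) \<one> = \<one>"
  by (meson comm_group_endo.endo_one funpow_endo)

lemma funpow_pow [simp]: "x \<in> carrier G \<Longrightarrow> (\<sigma> ^^ j) (x [^] (k::nat)) = (\<sigma> ^^ j) x [^] k"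
  by (meson comm_group_endo.endo_pow funpow_endo)

lemma funpow_inv [simp]: "x \<in> carrier G \<Longrightarrow> (\<sigma> ^^ j) (inv x) = inv ((\<sigma> ^^ j) x)"
  by (meson comm_group_endo.endo_inv funpow_endo)

lemma N_one [simp]: "N m \<one> = \<one>"
  by (induction m) simp_all

lemma N_mult: "x \<in> carrier G \<Longrightarrow> y \<in> carrier G \<Longrightarrow> N m (x \<otimes> y) = N m x \<otimes> N m y"
  by (induction m) (simp_all add: m_ac)

lemma N_pow: "x \<in> carrier G \<Longrightarrow> N m (x [^] (k::nat)) = N m x [^] k"
  by (induction k) (simp_all add: N_mult)

lemma N_inv: "x \<in> carrier G \<Longrightarrow> N m (inv x) = inv (N m x)"
  by (metis N_closed N_mult N_one inv_closed inv_equality l_inv)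

lemma S_mult: "x \<in> carrier G \<Longrightarrow> y \<in> carrier G \<Longrightarrow> S m (x \<otimes> y) = S m x \<otimes> S m y"
  by (induction m) (simp_all add: m_ac N_mult)

lemma S_one [simp]: "S m \<one> = \<one>"
  by (induction m) simp_all

lemma S_pow: "x \<in> carrier G \<Longrightarrow> S m (x [^] (k::nat)) = S m x [^] k"
  by (induction k) (simp_all add: S_mult)

section \<open>Telescoping identities for partial norms\<close>

lemma N_add: "x \<in> carrier G \<Longrightarrow> N (a + b) x = N a x \<otimes> (\<sigma> ^^ a) (N b x)"
  by (induction b) (simp_all add: m_assoc funpow_add)

lemma N_funpow: "x \<in> carrier G \<Longrightarrow> N m ((\<sigma> ^^ j) x) = (\<sigma> ^^ j) (N m x)"
  by (induction m) (simp_all add: funpow_add [symmetric, unfolded o_def, THEN fun_cong] add.commute)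

text \<open>Transitivity of norms: the exponents below \<open>a * b\<close> split into
  \<open>b\<close> blocks of length \<open>a\<close>, each the image of the first under a power of
  \<open>\<sigma> ^^ a\<close>.\<close>

lemma N_times: "x \<in> carrier G \<Longrightarrow> N (a * b) x = orbit_prod G (\<sigma> ^^ a) b (N a x)"
proof (induction b)
  case (Suc b)
  have "N (a * Suc b) x = N (a * b + a) x"
    by (simp add: add.commute)
  also have "\<dots> = N (a * b) x \<otimes> (\<sigma> ^^ (a * b)) (N a x)"
    using Suc by (simp add: N_add)
  finally show ?case
    using Suc by (simp add: funpow_mult mult.commute)
qed simp

lemma funpow_fixed: "(\<sigma> ^^ a) x = x \<Longrightarrow> (\<sigma> ^^ (a * t)) x = x"
  by (induction t) (simp_all add: funpow_add)

lemma N_fixed: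
  assumes "x \<in> carrier G" "\<sigma> x = x" shows "N m x = x [^] m"
  using assms funpow_fixed[of 1 x] by (induction m) simp_all

text \<open>Telescoping, \<open>(\<sigma> - 1) N_m = \<sigma>^m - 1\<close> in the group ring,
  multiplied out to avoid inverses.\<close>

lemma endo_N: "x \<in> carrier G \<Longrightarrow> \<sigma> (N m x) \<otimes> x = N m x \<otimes> (\<sigma> ^^ m) x"
proof (induction m)
  case (Suc m)
  have "\<sigma> (N (Suc m) x) \<otimes> x = (\<sigma> (N m x) \<otimes> x) \<otimes> \<sigma> ((\<sigma> ^^ m) x)"
    using Suc.prems by (simp add: m_ac)
  then show ?case
    using Suc by simp
qed simp

lemma endo_N_fixed:
  assumes "x \<in> carrier G" "(\<sigma> ^^ m) x = x" shows "\<sigma> (N m x) = N m x"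
  using endo_N[of x m] assms by simp

text \<open>Summing \<open>endo_N\<close> over the lengths below \<open>m\<close> gives
  \<open>(\<sigma> - 1) S_m = N_m - m\<close>, again without inverses.\<close>

lemma endo_S: "x \<in> carrier G \<Longrightarrow> \<sigma> (S m x) \<otimes> x [^] m = S m x \<otimes> N m x"
proof (induction m)
  case (Suc m)
  have "\<sigma> (S (Suc m) x) \<otimes> x [^] Suc m = (\<sigma> (S m x) \<otimes> x [^] m) \<otimes> (\<sigma> (N m x) \<otimes> x)"
    using Suc.prems by (simp add: m_ac)
  also have "\<dots> = S (Suc m) x \<otimes> N (Suc m) x"
    unfolding Suc.IH[OF Suc.prems] endo_N[OF Suc.prems] by simp
  finally show ?case .
qed simp

lemma funpow_of_quotient:
  assumes "\<theta> \<in> carrier G" "u \<in> carrier G" "\<sigma> \<theta> = \<theta> \<otimes> u"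
  shows "(\<sigma> ^^ m) \<theta> = \<theta> \<otimes> N m u"
proof (induction m)
  case (Suc m)
  have "(\<sigma> ^^ Suc m) \<theta> = (\<sigma> ^^ m) (\<sigma> \<theta>)"
    by (simp add: funpow_swap1)
  then show ?case
    using assms Suc by (simp add: m_ac)
qed (use assms in simp)

text \<open>Multiplying \<open>funpow_of_quotient\<close> over the exponents below \<open>m\<close>
  collects the partial norms of \<open>u\<close> into \<open>S\<close>. This is how \<open>S\<close>
  enters the explicit root of a norm.\<close>

lemma N_of_quotient:
  assumes "\<theta> \<in> carrier G" "u \<in> carrier G" "\<sigma> \<theta> = \<theta> \<otimes> u"
  shows "N m \<theta> = \<theta> [^] m \<otimes> S m u"
proof (induction m)
  case (Suc m)
  then show ?case
    using assms funpow_of_quotient[OF assms] by (simp add: m_ac)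
qed (use assms in simp)

lemma S_add:
  "x \<in> carrier G \<Longrightarrow> S (a + b) x = S a x \<otimes> N a x [^] b \<otimes> (\<sigma> ^^ a) (S b x)"
  by (induction b) (simp_all add: m_ac N_add)

lemma N_times_fixed:
  assumes "y \<in> carrier G" "(\<sigma> ^^ r) y = y"
  shows "N (r * t) y = N r y [^] t"
proof -
  interpret \<tau>: comm_group_endo G "\<sigma> ^^ r" by (rule funpow_endo)
  show ?thesis
    using assms by (simp add: N_times \<tau>.N_fixed flip: N_funpow)
qed

text \<open>As \<open>\<sigma> ^^ r\<close> fixes \<open>y\<close>, the partial norm of length
  \<open>r * j + l\<close> is \<open>N r y [^] j \<otimes> N l y\<close>. The product over
  \<open>l < r\<close> and then over \<open>j < t\<close> gives the two exponents.\<close>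

lemma S_times_fixed:
  assumes "y \<in> carrier G" "(\<sigma> ^^ r) y = y"
  shows "S (r * t) y = N r y [^] (r * \<Sum>{..<t}) \<otimes> S r y [^] t"
proof (induction t)
  case (Suc t)
  have S_fixed: "(\<sigma> ^^ r) (S m y) = S m y" for m
    by (induction m) (use assms in \<open>simp_all flip: N_funpow\<close>)
  have "S (r * Suc t) y = S (r * t + r) y"
    by (simp add: add.commute)
  also have "\<dots> = S (r * t) y \<otimes> N r y [^] (t * r) \<otimes> S r y"
    using assms S_fixed funpow_fixed
    by (simp add: S_add N_times_fixed nat_pow_pow)
  finally show ?case
    using assms Suc by (simp add: m_ac nat_pow_mult [symmetric] distrib_left mult.commute)
qed simp

text \<open>
  If \<open>y\<close> is fixed by \<open>\<sigma>\<^sup>r\<close>, the norm of \<open>\<delta>\<close> has the explicit \<open>p\<close>-th root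
  \<open>\<delta>\<^sup>r c\<^sup>e S\<^sub>r(y) S\<^sub>r\<^sub>p(k)\<close> with \<open>c = N\<^sub>r(y)\<close>, which \<open>\<sigma>\<close> multiplies by \<open>N\<^sub>r(y) N\<^sub>r\<^sub>p(k)\<close>.
\<close>

lemma N_is_pth_power_iff:
  assumes \<delta>: "\<delta> \<in> carrier G" and y: "y \<in> carrier G" and k: "k \<in> carrier G"
    and eq: "\<sigma> \<delta> = \<delta> \<otimes> y \<otimes> k [^] p"
    and fix_y: "(\<sigma> ^^ r) y = y"
    and even: "y = \<one> \<or> p dvd r * \<Sum>{..<p}"
    and roots: "\<And>z. z \<in> carrier G \<Longrightarrow> z [^] p = \<one> \<Longrightarrow> \<sigma> z = z"
  shows "(\<exists>f\<in>carrier G. \<sigma> f = f \<and> N (r * p) \<delta> = f [^] p) \<longleftrightarrow> N r y \<otimes> N (r * p) k = \<one>"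
proof -
  \<comment> \<open>The division is exact in the second case of \<open>even\<close>; in the first
    case \<open>c = \<one>\<close>, so the truncated exponent does no harm.\<close>
  define e where "e = r * \<Sum>{..<p} div p"
  define c where "c = N r y"
  define x where "x = \<delta> [^] r \<otimes> c [^] e \<otimes> S r y \<otimes> S (r * p) k"
  have c: "c \<in> carrier G" and fix_c: "\<sigma> c = c"
    using y fix_y endo_N_fixed by (auto simp: c_def)
  have ce: "c [^] (r * \<Sum>{..<p}) = (c [^] e) [^] p"
    using even y fix_y by (auto simp: c_def e_def nat_pow_pow)
  have x: "x \<in> carrier G"
    using \<delta> y k c by (simp add: x_def)
  define u where "u = y \<otimes> k [^] p"
  have u: "u \<in> carrier G" "\<sigma> \<delta> = \<delta> \<otimes> u"
    using y k \<delta> eq by (auto simp: u_def m_ac)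
  have Su: "S (r * p) u = (c [^] e) [^] p \<otimes> S r y [^] p \<otimes> S (r * p) k [^] p"
    using y k fix_y ce by (simp add: u_def S_mult S_pow S_times_fixed c_def)
  have x_root: "N (r * p) \<delta> = x [^] p"
    using y k \<delta> c u Su N_of_quotient[OF \<delta> u]
    by (simp add: x_def pow_mult_distrib m_ac nat_pow_pow)
  have Sy: "\<sigma> (S r y) \<otimes> y [^] r = S r y \<otimes> c"
    using endo_S y c_def by simp
  have Sk: "\<sigma> (S (r * p) k) \<otimes> k [^] (r * p) = S (r * p) k \<otimes> N (r * p) k"
    using endo_S k by simp
  have "\<sigma> x = (\<delta> [^] r \<otimes> y [^] r \<otimes> k [^] (r * p)) \<otimes> c [^] e \<otimes> \<sigma> (S r y) \<otimes> \<sigma> (S (r * p) k)"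
    using \<delta> y k c fix_c eq by (simp add: x_def pow_mult_distrib m_ac nat_pow_pow mult.commute)
  also have "\<dots> = \<delta> [^] r \<otimes> c [^] e \<otimes> (\<sigma> (S r y) \<otimes> y [^] r) \<otimes> (\<sigma> (S (r * p) k) \<otimes> k [^] (r * p))"
    using \<delta> y k c by (simp add: m_ac)
  also have "\<dots> = x \<otimes> (c \<otimes> N (r * p) k)"
    unfolding Sy Sk using \<delta> y k c by (simp add: x_def m_ac)
  finally have \<sigma>x: "\<sigma> x = x \<otimes> (c \<otimes> N (r * p) k)" .
  have cN: "c \<otimes> N (r * p) k \<in> carrier G"
    using c k by simp
  show ?thesis
  proof
    assume "\<exists>f\<in>carrier G. \<sigma> f = f \<and> N (r * p) \<delta> = f [^] p"
    then obtain f where f: "f \<in> carrier G" "\<sigma> f = f" "N (r * p) \<delta> = f [^] p"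
      by auto
    \<comment> \<open>Two \<open>p\<close>-th roots of the same element differ by a root of unity,
      which \<open>\<sigma>\<close> fixes; so the explicit root \<open>x\<close> is fixed as soon as
      some root is.\<close>
    define z where "z = x \<otimes> inv f"
    have z: "z \<in> carrier G" "x = z \<otimes> f"
      using x f by (auto simp: z_def m_assoc)
    have "z [^] p \<otimes> f [^] p = f [^] p"
      using z f x_root by (simp add: pow_mult_distrib m_comm)
    then have "\<sigma> z = z"
      using z f by (intro roots) simp_all
    then have "\<sigma> x = x"
      using z f by simp
    then show "N r y \<otimes> N (r * p) k = \<one>"
      using \<sigma>x x cN by (simp add: c_def)
  next
    assume "N r y \<otimes> N (r * p) k = \<one>"
    then show "\<exists>f\<in>carrier G. \<sigma> f = f \<and> N (r * p) \<delta> = f [^] p"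
      using x \<sigma>x x_root by (auto simp: c_def)
  qed
qed

end

section \<open>Abelian groups satisfying Hilbert 90\<close>

text \<open>The sum is \<open>p (p - 1) / 2\<close> and \<open>p - 1\<close> is even. For
  \<open>p = 2\<close> it equals 1, the source of the exceptional case.\<close>

lemma prime_dvd_sum_lessThan:
  fixes p :: nat
  assumes "Factorial_Ring.prime p" "p \<noteq> 2"
  shows "p dvd \<Sum>{..<p}"
proof -
  have "odd p"
    using assms by (simp add: primes_dvd_imp_eq two_is_prime_nat prime_odd_nat order_le_neq_trans[OF prime_ge_2_nat])
  then obtain m where m: "p = Suc (2 * m)"
    by (elim oddE) simp
  have "2 * \<Sum>{..<p} = p * (p - 1)"
    using gauss_sum_nat[of "p - 1"] m
    by (simp add: atLeast0AtMost lessThan_Suc_atMost)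
  then have "\<Sum>{..<p} = p * m"
    using m by simp
  then show ?thesis by simp
qed

text \<open>Models the unit group of a cyclic extension of degree \<open>p ^ n\<close>:
  \<open>\<xi>\<close> lies at the bottom and generates the \<open>p\<close>-th roots of unity, and
  Hilbert 90 holds over every intermediate level.\<close>

locale cyclic_p_module = comm_group_endo G \<sigma> for G (structure) and \<sigma> +
  fixes p n :: nat and \<xi> :: 'a
  assumes prime_p: "Factorial_Ring.prime p" and n_pos: "n \<ge> 1"
    and period: "x \<in> carrier G \<Longrightarrow> (\<sigma> ^^ (p ^ n)) x = x"
    and \<xi>_closed [simp]: "\<xi> \<in> carrier G" and \<xi>_fixed [simp]: "\<sigma> \<xi> = \<xi>"
    and \<xi>_pow [simp]: "\<xi> [^] p = \<one>" and \<xi>_neq_one: "\<xi> \<noteq> \<one>"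
    and roots: "z \<in> carrier G \<Longrightarrow> z [^] p = \<one> \<Longrightarrow> \<exists>j::nat. z = \<xi> [^] j"
    and hilbert90: "i \<le> n \<Longrightarrow> u \<in> carrier G \<Longrightarrow> orbit_prod G (\<sigma> ^^ (p ^ i)) (p ^ (n - i)) u = \<one>
      \<Longrightarrow> \<exists>\<theta>\<in>carrier G. (\<sigma> ^^ (p ^ i)) \<theta> = \<theta> \<otimes> u"
begin

section \<open>Levels of the tower and the four conditions\<close>

text \<open>For the units of \<open>K\<close>, the map \<open>level i\<close> generates the Galois
  group over \<open>K_i\<close>, so \<open>norm_down i\<close> below is the norm from
  \<open>K\<close> to \<open>K_i\<close>. On elements of \<open>K_i\<close>, the norm to the bottom
  is \<open>N (p ^ i)\<close>.\<close>

abbreviation level :: "nat \<Rightarrow> 'a \<Rightarrow> 'a" where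
  "level i \<equiv> \<sigma> ^^ (p ^ i)"

abbreviation norm_down :: "nat \<Rightarrow> 'a \<Rightarrow> 'a" where
  "norm_down i \<equiv> orbit_prod G (level i) (p ^ (n - i))"

fun fixed_units :: "nat option \<Rightarrow> 'a set" where
  "fixed_units None = {\<one>}"
| "fixed_units (Some i) = {x \<in> carrier G. level i x = x}"

text \<open>\<open>holds_A\<close>, \<open>holds_B\<close>, \<open>holds_C\<close> are the
  conditions of the three minima in order, and \<open>holds_I\<close> is that of
  \<open>i(K/F)\<close>. Equalities of classes are unfolded into factors \<open>k [^] p\<close>, and
  in \<open>holds_I\<close> the generator stands for the whole group.\<close>

definition holds_A :: "nat option \<Rightarrow> bool" where
  "holds_A s \<longleftrightarrow> (\<exists>\<gamma>\<in>carrier G. \<exists>x\<in>fixed_units s. \<xi> = N (p ^ n) \<gamma> \<otimes> N (p ^ (n - 1)) x)"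

definition holds_B :: "nat option \<Rightarrow> bool" where
  "holds_B s \<longleftrightarrow> (\<exists>k\<in>carrier G. \<xi> = norm_down (dot_succ s) k)"

definition holds_C :: "nat option \<Rightarrow> bool" where
  "holds_C s \<longleftrightarrow> (\<exists>\<delta>\<in>carrier G. (\<exists>k\<in>carrier G. level (dot_succ s) \<delta> = \<delta> \<otimes> k [^] p) \<and>
     \<not> (\<exists>f\<in>carrier G. level (dot_succ s) f = f \<and> norm_down (dot_succ s) \<delta> = f [^] p))"

definition holds_I :: "nat option \<Rightarrow> bool" where
  "holds_I s \<longleftrightarrow> (\<exists>\<delta>\<in>carrier G. \<not> (\<exists>f\<in>carrier G. \<sigma> f = f \<and> N (p ^ n) \<delta> = f [^] p) \<and>
     (\<exists>y\<in>fixed_units s. \<exists>k\<in>carrier G. \<sigma> \<delta> = \<delta> \<otimes> y \<otimes> k [^] p))"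

lemma p_pow_split: "i \<le> n \<Longrightarrow> p ^ i * p ^ (n - i) = p ^ n"
  by (simp flip: power_add)

lemma level_endo: "comm_group_endo G (level i)"
  by (rule funpow_endo)

lemma level_period: "i \<le> n \<Longrightarrow> x \<in> carrier G \<Longrightarrow> (level i ^^ (p ^ (n - i))) x = x"
  using period by (simp add: funpow_mult p_pow_split)

lemma fixed_level: "\<sigma> x = x \<Longrightarrow> level i x = x"
  using funpow_fixed[of 1 x "p ^ i"] by simp

lemma fixed_level_mono:
  assumes "level i x = x" "i \<le> j" shows "level j x = x"
  using funpow_fixed[OF assms(1), of "p ^ (j - i)"] assms(2) by (simp flip: power_add)

lemma norm_down_N: "i \<le> n \<Longrightarrow> x \<in> carrier G \<Longrightarrow> norm_down i (N (p ^ i) x) = N (p ^ n) x"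
  by (simp flip: N_times add: p_pow_split)

lemma norm_down_endo:
  assumes "x \<in> carrier G" shows "norm_down i (\<sigma> x) = \<sigma> (norm_down i x)"
proof -
  have "orbit_prod G (level i) m (\<sigma> x) = \<sigma> (orbit_prod G (level i) m x)" for m
  proof (induction m)
    case (Suc m)
    interpret \<tau>: comm_group_endo G "level i" by (rule level_endo)
    show ?case
      using Suc assms by (simp add: funpow_mult funpow_swap1)
  qed simp
  then show ?thesis .
qed

lemma root_fixed:
  assumes "z \<in> carrier G" "z [^] p = \<one>" shows "\<sigma> z = z"
  using roots[OF assms] by auto

text \<open>The \<open>p\<close>-th roots of unity form a group of prime order, so Bezout recovers
  \<open>\<xi>\<close> from any nontrivial one. This turns a nontrivial root of unity that is a norm
  into a representation of \<open>\<xi>\<close>.\<close>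

lemma root_generates:
  assumes "z \<in> carrier G" "z [^] p = \<one>" "z \<noteq> \<one>"
  shows "\<exists>l::nat. z [^] l = \<xi>"
proof -
  obtain j :: nat where j: "z = \<xi> [^] j"
    using roots assms by blast
  have pow_mod: "\<xi> [^] a = \<xi> [^] (a mod p)" for a :: nat
  proof -
    have "\<xi> [^] a = \<xi> [^] (p * (a div p) + a mod p)" by simp
    also have "\<dots> = (\<xi> [^] p) [^] (a div p) \<otimes> \<xi> [^] (a mod p)"
      by (simp only: nat_pow_mult nat_pow_pow \<xi>_closed)
    finally show ?thesis by simp
  qed
  have "\<not> p dvd j"
    using assms(3) pow_mod[of j] j by auto
  then have "coprime j p"
    using prime_p by (metis coprime_commute prime_imp_coprime_nat)
  moreover have "j \<noteq> 0"
    using \<open>\<not> p dvd j\<close> dvd_0_right by metis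
  ultimately obtain l m where "j * l = p * m + 1"
    using bezout_nat[of j p] by auto
  then have "\<xi> [^] (j * l) = \<xi> [^] (p * m + 1)"
    by (simp only:)
  also have "\<dots> = (\<xi> [^] p) [^] m \<otimes> \<xi>"
    by (simp only: nat_pow_mult [symmetric] nat_pow_pow nat_pow_eone \<xi>_closed)
  finally have "\<xi> [^] (j * l) = \<xi>"
    by simp
  then show ?thesis
    by (metis j nat_pow_pow \<xi>_closed)
qed

section \<open>Restriction and inflation between levels\<close>

text \<open>If \<open>\<sigma> a = a\<close> is a norm from level \<open>n\<close> to level \<open>i\<close>, then Hilbert 90 for \<open>\<sigma> k / k\<close>
  makes \<open>a\<close> a \<open>p\<^sup>n\<^sup>-\<^sup>i\<close>-th power up to norms to the bottom.\<close>

lemma norm_restriction: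
  assumes i: "i \<le> n" and k: "k \<in> carrier G" and fixed: "\<sigma> (norm_down i k) = norm_down i k"
  obtains z \<theta> where "z \<in> carrier G" "\<theta> \<in> carrier G" "\<sigma> z = z"
    "norm_down i k = z [^] (p ^ (n - i)) \<otimes> N (p ^ n) \<theta>"
proof -
  interpret \<tau>: comm_group_endo G "level i" by (rule level_endo)
  define u where "u = \<sigma> k \<otimes> inv k"
  have u: "u \<in> carrier G" "\<sigma> k = k \<otimes> u"
    using k quotient_cancel[of k "\<sigma> k"] by (auto simp: u_def)
  have "norm_down i u = \<one>"
    using k fixed by (simp add: u_def \<tau>.N_mult \<tau>.N_inv norm_down_endo)
  then obtain \<theta> where \<theta>: "\<theta> \<in> carrier G" "level i \<theta> = \<theta> \<otimes> u"
    using hilbert90 i u by blast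
  \<comment> \<open>By telescoping, \<open>\<sigma> w / w = level i \<theta> / \<theta> = u =
    \<sigma> k / k\<close>, so \<open>k / w\<close> is fixed by \<open>\<sigma>\<close>.\<close>
  define w where "w = N (p ^ i) \<theta>"
  have w: "w \<in> carrier G"
    using \<theta> by (simp add: w_def)
  have "\<sigma> w \<otimes> \<theta> = w \<otimes> u \<otimes> \<theta>"
    using endo_N[OF \<theta>(1), of "p ^ i"] \<theta> u w by (simp add: w_def m_ac)
  then have \<sigma>w: "\<sigma> w = w \<otimes> u"
    using \<theta> u w by simp
  define z where "z = k \<otimes> inv w"
  have z: "z \<in> carrier G" "k = z \<otimes> w"
    using k w by (auto simp: z_def m_assoc)
  have "\<sigma> z \<otimes> (w \<otimes> u) = z \<otimes> (w \<otimes> u)"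
    using u(2) z w u(1) \<sigma>w by (simp add: m_assoc)
  then have fix_z: "\<sigma> z = z"
    using z w u by simp
  have "norm_down i k = z [^] (p ^ (n - i)) \<otimes> N (p ^ n) \<theta>"
    using z w \<theta> i fixed_level[OF fix_z]
    by (simp add: \<tau>.N_mult \<tau>.N_fixed norm_down_N w_def)
  then show thesis
    using that z \<theta> fix_z by blast
qed

text \<open>Inflation sends the class of \<open>z\<close> modulo norms from level \<open>i\<close>
  to that of \<open>z [^] (p ^ (n - i))\<close> modulo norms from the top; this is its injectivity.
  Hilbert 90 for \<open>v / z\<close> supplies the factor by which \<open>w\<close> must be
  corrected.\<close>

lemma norm_inflation:
  assumes i: "i \<le> n" and z: "z \<in> carrier G" "\<sigma> z = z" and w: "w \<in> carrier G"
    and eq: "z [^] (p ^ (n - i)) = N (p ^ n) w"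
  obtains b where "b \<in> carrier G" "level i b = b" "N (p ^ i) b = z"
proof -
  interpret \<tau>: comm_group_endo G "level i" by (rule level_endo)
  define v where "v = N (p ^ i) w"
  have v: "v \<in> carrier G"
    using w by (simp add: v_def)
  have "norm_down i (v \<otimes> inv z) = \<one>"
    using v w z i eq fixed_level[OF z(2)]
    by (simp add: \<tau>.N_mult \<tau>.N_inv \<tau>.N_fixed norm_down_N v_def nat_pow_inv)
  then obtain \<theta> where \<theta>: "\<theta> \<in> carrier G" "level i \<theta> = \<theta> \<otimes> (v \<otimes> inv z)"
    using hilbert90[OF i] v z by (metis inv_closed m_closed)
  define u where "u = \<sigma> \<theta> \<otimes> inv \<theta>"
  have u: "u \<in> carrier G" "\<sigma> \<theta> = \<theta> \<otimes> u"
    using \<theta> quotient_cancel[of \<theta> "\<sigma> \<theta>"] by (auto simp: u_def)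
  have Nu: "N (p ^ i) u = v \<otimes> inv z"
    using funpow_of_quotient[OF \<theta>(1) u, of "p ^ i"] \<theta> u v z by simp
  define b where "b = w \<otimes> inv u"
  have b: "b \<in> carrier G"
    using w u by (simp add: b_def)
  have Nb: "N (p ^ i) b = z"
    using w u v z Nu by (simp add: b_def N_mult N_inv inv_mult_group flip: v_def quotient_cancel)
  \<comment> \<open>That \<open>b\<close> lies in level \<open>i\<close> is not built in:
    telescoping derives it from \<open>N (p ^ i) b = z\<close> being fixed by
    \<open>\<sigma>\<close>.\<close>
  have "z \<otimes> b = z \<otimes> level i b"
    using endo_N[OF b, of "p ^ i"] z Nb by simp
  then have "level i b = b"
    using b z by simp
  then show thesis
    using that b Nb by blast
qed

text \<open>At \<open>None\<close> both sides say that \<open>\<xi>\<close> is a norm from top to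
  bottom. At \<open>Some i\<close> the converse direction combines restriction from level
  \<open>Suc i\<close>, the relation \<open>\<xi> [^] p = \<one>\<close>, and inflation at level
  \<open>i\<close>.\<close>

lemma holds_A_iff_holds_B:
  assumes "s \<in> indices_below n"
  shows "holds_A s \<longleftrightarrow> holds_B s"
proof (cases s)
  case None
  then show ?thesis
    by (auto simp: holds_A_def holds_B_def)
next
  case (Some i)
  then have i: "i < n"
    using assms by (auto simp: indices_below_def)
  interpret \<tau>: comm_group_endo G "level (Suc i)" by (rule level_endo)
  have split: "p ^ i * p ^ (n - Suc i) = p ^ (n - 1)"
    using i by (simp flip: power_add)
  show ?thesis
  proof
    assume "holds_A s"
    then obtain \<gamma> x where \<gamma>: "\<gamma> \<in> carrier G" and x: "x \<in> carrier G" "level i x = x"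
      and \<xi>: "\<xi> = N (p ^ n) \<gamma> \<otimes> N (p ^ (n - 1)) x"
      using Some by (auto simp: holds_A_def)
    \<comment> \<open>\<open>N (p ^ i) x\<close> is fixed by \<open>\<sigma>\<close>, so
      \<open>norm_down (Suc i)\<close> raises it to the power \<open>p ^ (n - Suc i)\<close>; that
      power is also \<open>N (p ^ (n - 1)) x\<close>.\<close>
    define k where "k = N (p ^ i) x \<otimes> N (p ^ Suc i) \<gamma>"
    have "norm_down (Suc i) k = N (p ^ i) x [^] (p ^ (n - Suc i)) \<otimes> N (p ^ n) \<gamma>"
      using x \<gamma> i norm_down_N[of "Suc i" \<gamma>] fixed_level[OF endo_N_fixed[OF x]]
      unfolding k_def by (simp only: \<tau>.N_mult \<tau>.N_fixed N_closed Suc_leI)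
    also have "N (p ^ i) x [^] (p ^ (n - Suc i)) = N (p ^ (n - 1)) x"
      using N_times_fixed[OF x] split by metis
    finally have "norm_down (Suc i) k = \<xi>"
      using \<xi> \<gamma> x by (simp add: m_comm)
    moreover have "k \<in> carrier G"
      using \<gamma> x by (simp add: k_def)
    ultimately show "holds_B s"
      using Some by (auto simp: holds_B_def)
  next
    assume "holds_B s"
    then obtain k where k: "k \<in> carrier G" "\<xi> = norm_down (Suc i) k"
      using Some by (auto simp: holds_B_def)
    obtain z \<theta> where z: "z \<in> carrier G" "\<sigma> z = z" and \<theta>: "\<theta> \<in> carrier G"
      and \<xi>: "\<xi> = z [^] (p ^ (n - Suc i)) \<otimes> N (p ^ n) \<theta>"
      using norm_restriction[of "Suc i" k] k i \<xi>_fixed by (metis Suc_leI)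
    \<comment> \<open>The \<open>p\<close>-th power kills \<open>\<xi>\<close> and moves the
      exponent from \<open>n - Suc i\<close> to \<open>n - i\<close>, which is what inflation at
      level \<open>i\<close> needs.\<close>
    have "z [^] (p ^ (n - i)) \<otimes> N (p ^ n) (\<theta> [^] p) = \<xi> [^] p"
      using z \<theta> i unfolding \<xi>
      by (simp add: pow_mult_distrib m_comm nat_pow_pow N_pow Suc_diff_Suc flip: power_Suc2)
    then have "z [^] (p ^ (n - i)) = N (p ^ n) (inv (\<theta> [^] p))"
      using z \<theta> by (simp add: N_inv inv_equality flip: inv_equality)
    then obtain b where b: "b \<in> carrier G" "level i b = b" "N (p ^ i) b = z"
      using norm_inflation[of i z "inv (\<theta> [^] p)"] i z \<theta> by auto
    have "N (p ^ (n - 1)) b = z [^] (p ^ (n - Suc i))"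
      using N_times_fixed[OF b(1,2)] split b(3) by metis
    then have "\<xi> = N (p ^ n) \<theta> \<otimes> N (p ^ (n - 1)) b"
      using \<xi> \<theta> z by (simp add: m_comm)
    moreover have "b \<in> fixed_units s"
      using Some b by simp
    ultimately show "holds_A s"
      using \<theta> unfolding holds_A_def by blast
  qed
qed

section \<open>Norms that are not p-th powers\<close>

text \<open>\<open>N_is_pth_power_iff\<close> over level \<open>i\<close> with
  \<open>y = \<one>\<close>: the norm of \<open>\<delta>\<close> is a \<open>p\<close>-th power
  there iff the norm of \<open>k\<close> is trivial. The hypothesis makes \<open>p\<close> divide
  the degree \<open>p ^ (n - i)\<close>.\<close>

lemma holds_B_iff_holds_C:
  assumes "dot_succ s < n"
  shows "holds_B s \<longleftrightarrow> holds_C s"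
proof -
  define i where "i = dot_succ s"
  define m where "m = p ^ (n - Suc i)"
  have i: "i < n" and m: "m * p = p ^ (n - i)"
    using assms by (auto simp: i_def m_def Suc_diff_Suc simp flip: power_Suc2)
  interpret \<tau>: comm_group_endo G "level i" by (rule level_endo)
  have key: "(\<exists>f\<in>carrier G. level i f = f \<and> norm_down i \<delta> = f [^] p) \<longleftrightarrow> norm_down i k = \<one>"
    if "\<delta> \<in> carrier G" "k \<in> carrier G" "level i \<delta> = \<delta> \<otimes> k [^] p" for \<delta> k
    using \<tau>.N_is_pth_power_iff[of \<delta> \<one> k p m] that root_fixed fixed_level by (simp add: m)
  show ?thesis
  proof
    assume "holds_B s"
    then obtain k where k: "k \<in> carrier G" "norm_down i k = \<xi>"
      by (auto simp: holds_B_def i_def)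
    \<comment> \<open>A norm equal to \<open>\<xi>\<close> becomes trivial for the
      \<open>p\<close>-th power, so Hilbert 90 yields \<open>\<delta>\<close>.\<close>
    then have "norm_down i (k [^] p) = \<one>"
      by (simp add: \<tau>.N_pow)
    then obtain \<delta> where "\<delta> \<in> carrier G" "level i \<delta> = \<delta> \<otimes> k [^] p"
      using hilbert90[of i "k [^] p"] i k by auto
    then show "holds_C s"
      using key k \<xi>_neq_one unfolding holds_C_def i_def by blast
  next
    assume "holds_C s"
    then obtain \<delta> k where \<delta>: "\<delta> \<in> carrier G" and k: "k \<in> carrier G"
      and eq: "level i \<delta> = \<delta> \<otimes> k [^] p"
      and not: "\<not> (\<exists>f\<in>carrier G. level i f = f \<and> norm_down i \<delta> = f [^] p)"
      unfolding holds_C_def i_def by blast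
    \<comment> \<open>Going once around the cyclic group returns \<open>\<delta>\<close>, so
      \<open>k [^] p\<close> has trivial norm and the norm of \<open>k\<close> is a root of
      unity.\<close>
    have "\<delta> \<otimes> norm_down i (k [^] p) = \<delta>"
      using \<tau>.funpow_of_quotient[OF \<delta> _ eq] k level_period[of i \<delta>] i \<delta> by simp
    then have "norm_down i k [^] p = \<one>"
      using \<delta> k by (simp add: \<tau>.N_pow)
    moreover have "norm_down i k \<noteq> \<one>"
      using key[OF \<delta> k eq] not by blast
    ultimately obtain l :: nat where "norm_down i k [^] l = \<xi>"
      using root_generates k \<tau>.N_closed by blast
    then have "\<xi> = norm_down i (k [^] l)"
      using k by (simp add: \<tau>.N_pow)
    then show "holds_B s"
      using k unfolding holds_B_def i_def by blast
  qed
qed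

lemma fixed_units_subset: "fixed_units s \<subseteq> carrier G"
  by (cases s) auto

lemma fixed_units_pow: "y \<in> fixed_units s \<Longrightarrow> y [^] (l::nat) \<in> fixed_units s"
  by (cases s) auto

lemma fixed_units_N: "y \<in> fixed_units s \<Longrightarrow> N j y \<in> fixed_units s"
  by (cases s) (auto simp flip: N_funpow)

text \<open>The product \<open>N r y \<otimes> N (p ^ n) k\<close> is a \<open>p\<close>-th root of
  unity, nontrivial exactly when the norm of \<open>\<delta>\<close> is no \<open>p\<close>-th power
  at the bottom; a power of it is then \<open>\<xi>\<close>. Conversely Hilbert 90 produces
  \<open>\<delta>\<close>. The second hypothesis gives the divisibility behind the explicit
  root.\<close>

lemma holds_I_iff_holds_A:
  assumes s: "s \<in> indices_below n" and not_exceptional: "s = None \<or> p \<noteq> 2 \<or> n > 1"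
  shows "holds_I s \<longleftrightarrow> holds_A s"
proof -
  define r where "r = p ^ (n - 1)"
  have r: "r * p = p ^ n"
    using n_pos by (simp add: r_def flip: power_Suc2)
  have fix_y: "(\<sigma> ^^ r) y = y" if "y \<in> fixed_units s" for y
  proof (cases s)
    case None
    then show ?thesis using that by simp
  next
    case (Some i)
    then show ?thesis
      using that s fixed_level_mono[of i y "n - 1"] by (auto simp: r_def indices_below_def)
  qed
  have even: "y = \<one> \<or> p dvd r * \<Sum>{..<p}" if "y \<in> fixed_units s" for y
  proof (cases s)
    case None
    then show ?thesis using that by simp
  next
    case (Some i)
    then consider "p \<noteq> 2" | "n > 1"
      using not_exceptional by blast
    then show ?thesis
    proof cases
      case 1
      then show ?thesis using prime_dvd_sum_lessThan[OF prime_p] by simp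
    next
      case 2
      then have "p dvd r" by (simp add: r_def dvd_power)
      then show ?thesis by simp
    qed
  qed
  have key: "(\<exists>f\<in>carrier G. \<sigma> f = f \<and> N (p ^ n) \<delta> = f [^] p) \<longleftrightarrow> N r y \<otimes> N (p ^ n) k = \<one>"
    if "\<delta> \<in> carrier G" "y \<in> fixed_units s" "k \<in> carrier G" "\<sigma> \<delta> = \<delta> \<otimes> y \<otimes> k [^] p" for \<delta> y k
  proof -
    have "y \<in> carrier G"
      using that fixed_units_subset by blast
    then show ?thesis
      using N_is_pth_power_iff[of \<delta> y k p r] that root_fixed fix_y even by (simp add: r)
  qed
  \<comment> \<open>\<open>y\<close> is fixed by \<open>\<sigma> ^^ r\<close>, so its norm over all
    \<open>r * p\<close> exponents is the \<open>p\<close>-th power of \<open>N r y\<close>.\<close>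
  have N_pow_p: "N (p ^ n) (y \<otimes> k [^] p) = (N r y \<otimes> N (p ^ n) k) [^] p"
    if "y \<in> fixed_units s" "k \<in> carrier G" for y k
    using that fixed_units_subset[of s] N_times_fixed[of y r p] fix_y
    by (auto simp: N_mult N_pow pow_mult_distrib m_comm r)
  show ?thesis
  proof
    assume "holds_I s"
    then obtain \<delta> y k where \<delta>: "\<delta> \<in> carrier G" and y: "y \<in> fixed_units s" and k: "k \<in> carrier G"
      and eq: "\<sigma> \<delta> = \<delta> \<otimes> y \<otimes> k [^] p"
      and not: "\<not> (\<exists>f\<in>carrier G. \<sigma> f = f \<and> N (p ^ n) \<delta> = f [^] p)"
      unfolding holds_I_def by blast
    have y': "y \<in> carrier G"
      using y fixed_units_subset by blast
    have "\<delta> \<otimes> N (p ^ n) (y \<otimes> k [^] p) = \<delta>"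
      using funpow_of_quotient[of \<delta> "y \<otimes> k [^] p" "p ^ n"] eq \<delta> y' k period by (simp add: m_assoc)
    then have "(N r y \<otimes> N (p ^ n) k) [^] p = \<one>"
      using \<delta> y' k N_pow_p[OF y k] by simp
    moreover have "N r y \<otimes> N (p ^ n) k \<noteq> \<one>"
      using key[OF \<delta> y k eq] not by blast
    ultimately obtain l :: nat where "(N r y \<otimes> N (p ^ n) k) [^] l = \<xi>"
      using root_generates y' k by (metis N_closed m_closed)
    then have "\<xi> = N (p ^ n) (k [^] l) \<otimes> N r (y [^] l)"
      using y' k by (simp add: N_pow pow_mult_distrib m_comm)
    then show "holds_A s"
      using k fixed_units_pow[OF y] unfolding holds_A_def r_def by blast
  next
    assume "holds_A s"
    then obtain k y where k: "k \<in> carrier G" and y: "y \<in> fixed_units s"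
      and \<xi>: "\<xi> = N (p ^ n) k \<otimes> N r y"
      unfolding holds_A_def r_def by blast
    have y': "y \<in> carrier G"
      using y fixed_units_subset by blast
    have \<xi>': "N r y \<otimes> N (p ^ n) k = \<xi>"
      using \<xi> y' k by (simp add: m_comm)
    then have "norm_down 0 (y \<otimes> k [^] p) = \<one>"
      using N_pow_p[OF y k] by simp
    then obtain \<delta> where \<delta>: "\<delta> \<in> carrier G" "\<sigma> \<delta> = \<delta> \<otimes> (y \<otimes> k [^] p)"
      using hilbert90[of 0 "y \<otimes> k [^] p"] y' k by auto
    then have "\<sigma> \<delta> = \<delta> \<otimes> y \<otimes> k [^] p"
      using y' k by (simp add: m_assoc)
    then show "holds_I s"
      using key[OF \<delta>(1) y k] \<delta> y k \<xi>' \<xi>_neq_one unfolding holds_I_def by metis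
  qed
qed

section \<open>The top index and the minima\<close>

text \<open>Here \<open>dot_succ\<close> is \<open>n\<close>, where the norm is a product of length
  1, so \<open>\<xi>\<close> is its own norm.\<close>

lemma holds_B_top: "holds_B (Some (n - 1))"
  using n_pos by (auto simp: holds_B_def intro!: bexI[of _ \<xi>])

text \<open>An element witnessing \<open>holds_I\<close> is not a \<open>p\<close>-th power, as its norm is not one.\<close>

lemma holds_C_top:
  assumes "holds_I s" shows "holds_C (Some (n - 1))"
proof -
  obtain \<delta> where \<delta>: "\<delta> \<in> carrier G" "\<not> (\<exists>f\<in>carrier G. \<sigma> f = f \<and> N (p ^ n) \<delta> = f [^] p)"
    using assms unfolding holds_I_def by blast
  have "\<delta> \<noteq> f [^] p" if "f \<in> carrier G" for f
    using \<delta> that by (metis N_closed N_pow endo_N_fixed period)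
  \<comment> \<open>At index \<open>n\<close> the level acts trivially and the norm is the identity,
    so \<open>k = \<one>\<close> serves and only \<open>\<delta>\<close> not being a
    \<open>p\<close>-th power is left.\<close>
  then show ?thesis
    using n_pos \<delta>(1) period unfolding holds_C_def
    by (intro bexI[of _ \<delta>] conjI bexI[of _ \<one>]) auto
qed

text \<open>Non-emptiness is asserted because \<open>Min\<close> of the empty set is
  unspecified.\<close>

theorem Min_indices:
  assumes exceptional: "p = 2 \<Longrightarrow> n > 1 \<or> holds_B None"
  shows "{s \<in> indices_below (n + 1). holds_I s} \<noteq> {}"
    and "{s \<in> indices_below n. holds_A s} \<noteq> {}"
    and "{s \<in> indices_below n. holds_B s} \<noteq> {}"
    and "{s \<in> indices_below n. holds_C s} \<noteq> {}"
    and "Min {s \<in> indices_below (n + 1). holds_I s} = Min {s \<in> indices_below n. holds_A s}"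
    and "Min {s \<in> indices_below n. holds_A s} = Min {s \<in> indices_below n. holds_B s}"
    and "Min {s \<in> indices_below n. holds_B s} = Min {s \<in> indices_below n. holds_C s}"
proof -
  let ?I = "{s \<in> indices_below (n + 1). holds_I s}"
  let ?A = "{s \<in> indices_below n. holds_A s}"
  let ?B = "{s \<in> indices_below n. holds_B s}"
  let ?C = "{s \<in> indices_below n. holds_C s}"
  have fin: "finite (indices_below m)" for m
    by (simp add: indices_below_def)
  have top: "Some (n - 1) \<in> indices_below n"
    using n_pos by (simp add: indices_below_def)
  have AB: "?A = ?B"
    using holds_A_iff_holds_B by auto
  have A_ne: "?A \<noteq> {}"
    using AB top holds_B_top by blast
  have Min_I: "?I \<noteq> {} \<and> Min ?I = Min ?A"
  proof (cases "p \<noteq> 2 \<or> n > 1")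
    case True
    then have I_iff: "s \<in> ?I \<longleftrightarrow> s \<in> ?A" if "s \<in> indices_below n" for s
      using holds_I_iff_holds_A that by (auto simp: indices_below_def)
    \<comment> \<open>The candidates for \<open>i(K/F)\<close> admit one more index,
      \<open>Some n\<close>; it lies above \<open>Min ?A\<close> and so cannot affect the
      minimum.\<close>
    have above: "Min ?A \<le> s" if "s \<in> indices_below (n + 1)" "s \<notin> indices_below n" for s
    proof -
      have "s = Some n"
        using that by (auto simp: indices_below_def lessThan_Suc)
      moreover have "Min ?A \<in> indices_below n"
        using Min_in[of ?A] fin A_ne by auto
      ultimately show ?thesis
        by (auto simp: indices_below_def)
    qed
    have "Min ?A \<in> ?I"
      using Min_in[of ?A] fin A_ne I_iff by auto
    moreover have "Min ?A \<le> s" if "s \<in> ?I" for s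
      using that above I_iff fin by (cases "s \<in> indices_below n") auto
    ultimately show ?thesis
      using fin Min_eqI[of ?I "Min ?A"] by auto
  next
    case False
    \<comment> \<open>Only \<open>p = 2\<close>, \<open>n = 1\<close> is left. There
      \<open>None\<close> satisfies the conditions, and as the least index it is each
      minimum.\<close>
    then have "None \<in> ?A"
      using AB exceptional by (auto simp: indices_below_def)
    moreover from this have "None \<in> ?I"
      using holds_I_iff_holds_A by (auto simp: indices_below_def)
    moreover have "Min M = None" if "finite M" "None \<in> M" for M :: "nat option set"
      using that by (intro Min_eqI) auto
    ultimately show ?thesis
      using fin by auto
  qed
  have BC: "?B = ?C"
  proof -
    have "holds_B s \<longleftrightarrow> holds_C s" if "s \<in> indices_below n" for s
    proof (cases "dot_succ s < n")
      case False
      \<comment> \<open>At the top index both conditions hold outright; \<open>holds_C\<close> needs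
        a witness of \<open>holds_I\<close>, which the non-emptiness in \<open>Min_I\<close>
        provides.\<close>
      then have "s = Some (n - 1)"
        using that n_pos by (cases s) (auto simp: indices_below_def)
      then show ?thesis
        using holds_B_top holds_C_top Min_I by auto
    qed (rule holds_B_iff_holds_C)
    then show ?thesis by auto
  qed
  show "?I \<noteq> {}" "?A \<noteq> {}" "?B \<noteq> {}" "?C \<noteq> {}" "Min ?I = Min ?A" "Min ?A = Min ?B" "Min ?B = Min ?C"
    using Min_I A_ne AB BC by auto
qed

end

section \<open>Independence of characters\<close>

text \<open>Gaussian elimination by induction on the equations: removing one equation together with
  a pivot unknown keeps the unknowns in excess.\<close>

lemma (in field) homogeneous_system:
  assumes "finite I" "finite J" "card I < card J"
    and "\<And>i j. i \<in> I \<Longrightarrow> j \<in> J \<Longrightarrow> A i j \<in> carrier R"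
  shows "\<exists>x. x \<in> J \<rightarrow> carrier R \<and> (\<exists>j\<in>J. x j \<noteq> \<zero>) \<and> (\<forall>i\<in>I. (\<Oplus>j\<in>J. A i j \<otimes> x j) = \<zero>)"
  using assms
proof (induction I arbitrary: J A rule: finite_induct)
  case empty
  then obtain j where "j \<in> J" by fastforce
  then show ?case
    by (intro exI[of _ "\<lambda>_. \<one>"]) auto
next
  case (insert i0 I)
  show ?case
  proof (cases "\<forall>j\<in>J. A i0 j = \<zero>")
    case True
    obtain x where x: "x \<in> J \<rightarrow> carrier R" "\<exists>j\<in>J. x j \<noteq> \<zero>" "\<forall>i\<in>I. (\<Oplus>j\<in>J. A i j \<otimes> x j) = \<zero>"
      using insert.IH[of J A] insert.prems insert.hyps by auto
    have "(\<Oplus>j\<in>J. A i0 j \<otimes> x j) = (\<Oplus>j\<in>J. \<zero>)"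
      using True x by (intro finsum_cong') (auto simp: Pi_iff)
    then show ?thesis
      using x by auto
  next
    case False
    then obtain j0 where j0: "j0 \<in> J" "A i0 j0 \<noteq> \<zero>" by blast
    define a where "a = A i0 j0"
    have a: "a \<in> carrier R" "inv a \<in> carrier R" "a \<otimes> inv a = \<one>"
      using j0 insert.prems field_Units by (auto simp: a_def)
    define J' where "J' = J - {j0}"
    have J': "J = insert j0 J'" "j0 \<notin> J'" "finite J'" "card I < card J'"
      using j0 insert by (auto simp: J'_def)
    have A: "A i j \<in> carrier R" if "i \<in> insert i0 I" "j \<in> insert j0 J'" for i j
      using that insert.prems J' by auto
    \<comment> \<open>Adding \<open>c i\<close> times equation \<open>i0\<close> clears the pivot
      column \<open>j0\<close> in equation \<open>i\<close>.\<close>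
    define c where "c i = \<ominus> (A i j0 \<otimes> inv a)" for i
    have c: "c i \<in> carrier R" if "i \<in> I" for i
      using that A a by (simp add: c_def)
    obtain x where x: "x \<in> J' \<rightarrow> carrier R" "\<exists>j\<in>J'. x j \<noteq> \<zero>"
      and zero: "\<And>i. i \<in> I \<Longrightarrow> (\<Oplus>j\<in>J'. (A i j \<oplus> c i \<otimes> A i0 j) \<otimes> x j) = \<zero>"
    proof -
      have "\<exists>x. x \<in> J' \<rightarrow> carrier R \<and> (\<exists>j\<in>J'. x j \<noteq> \<zero>) \<and>
          (\<forall>i\<in>I. (\<Oplus>j\<in>J'. (A i j \<oplus> c i \<otimes> A i0 j) \<otimes> x j) = \<zero>)"
        using J' A c by (intro insert.IH) auto
      then show thesis
        using that by blast
    qed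
    have xc: "x j \<in> carrier R" if "j \<in> J'" for j
      using x that by auto
    define s where "s i = (\<Oplus>j\<in>J'. A i j \<otimes> x j)" for i
    have s: "s i \<in> carrier R" if "i \<in> insert i0 I" for i
      using that A xc unfolding s_def by (intro finsum_closed) auto
    \<comment> \<open>Back substitution: the pivot unknown is solved for in equation
      \<open>i0\<close>.\<close>
    define y where "y = x(j0 := \<ominus> (inv a \<otimes> s i0))"
    have y: "y \<in> J \<rightarrow> carrier R"
      using x J' a s by (auto simp: y_def)
    have y_nonzero: "\<exists>j\<in>J. y j \<noteq> \<zero>"
      using x(2) J' unfolding y_def by (metis fun_upd_other insertI2)
    have split: "(\<Oplus>j\<in>J. A i j \<otimes> y j) = A i j0 \<otimes> \<ominus> (inv a \<otimes> s i0) \<oplus> s i" if "i \<in> insert i0 I" for i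
    proof -
      have "(\<Oplus>j\<in>J'. A i j \<otimes> y j) = s i"
        unfolding s_def using J' A that xc by (intro finsum_cong') (auto simp: y_def)
      then show ?thesis
        using J' A that y unfolding J'(1) by (subst finsum_insert) (auto simp: y_def Pi_iff)
    qed
    have "(\<Oplus>j\<in>J. A i j \<otimes> y j) = \<zero>" if i: "i \<in> insert i0 I" for i
    proof (cases "i = i0")
      case True
      have "a \<otimes> \<ominus> (inv a \<otimes> s i0) = \<ominus> ((a \<otimes> inv a) \<otimes> s i0)"
        using a(1,2) s[of i0] by (simp add: r_minus m_assoc)
      then show ?thesis
        using split[OF i] True a s by (simp add: l_neg flip: a_def)
    next
      case False
      then have i: "i \<in> I" using that by simp
      have "\<zero> = (\<Oplus>j\<in>J'. A i j \<otimes> x j \<oplus> c i \<otimes> (A i0 j \<otimes> x j))"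
        unfolding zero[OF i, symmetric] using A c xc i
        by (intro finsum_cong') (auto simp: l_distr m_assoc)
      also have "\<dots> = s i \<oplus> c i \<otimes> s i0"
        unfolding s_def using A c xc i J'
        by (subst finsum_addf) (auto simp: finsum_rdistr)
      also have "c i \<otimes> s i0 = A i j0 \<otimes> \<ominus> (inv a \<otimes> s i0)"
        using A a s i by (simp add: c_def l_minus r_minus m_assoc)
      finally show ?thesis
        using split[of i] A a s i by (simp add: a_comm)
    qed
    then show ?thesis
      using y y_nonzero by blast
  qed
qed

text \<open>The relation at the product of \<open>x\<close> and \<open>y\<close>, minus
  \<open>\<chi> m y\<close> times the relation at \<open>x\<close>, no longer involves
  \<open>m\<close>. An arbitrary monoid is allowed as source so that both automorphisms and the
  exponential maps on the naturals are covered.\<close>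

lemma (in field) dedekind_independence:
  assumes "monoid G" and "finite J"
    and "\<And>j. j \<in> J \<Longrightarrow> \<chi> j \<in> hom G R" and "\<And>j. j \<in> J \<Longrightarrow> \<chi> j \<one>\<^bsub>G\<^esub> = \<one>"
    and "\<And>i j. i \<in> J \<Longrightarrow> j \<in> J \<Longrightarrow> i \<noteq> j \<Longrightarrow> \<exists>x\<in>carrier G. \<chi> i x \<noteq> \<chi> j x"
    and "\<And>j. j \<in> J \<Longrightarrow> c j \<in> carrier R"
    and "\<And>x. x \<in> carrier G \<Longrightarrow> (\<Oplus>j\<in>J. c j \<otimes> \<chi> j x) = \<zero>"
  shows "\<forall>j\<in>J. c j = \<zero>"
  using assms(2-)
proof (induction J arbitrary: c rule: finite_induct)
  case (insert m J)
  interpret G: monoid G by fact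
  have \<chi>: "\<chi> j x \<in> carrier R" if "j \<in> insert m J" "x \<in> carrier G" for j x
    using insert.prems(1) that by (auto simp: hom_def)
  have \<chi>_mult: "\<chi> j (x \<otimes>\<^bsub>G\<^esub> y) = \<chi> j x \<otimes> \<chi> j y"
    if "j \<in> insert m J" "x \<in> carrier G" "y \<in> carrier G" for j x y
    using insert.prems(1) that by (auto simp: hom_def)
  note c = insert.prems(4)
  have cJ: "c j = \<zero>" if j: "j \<in> J" for j
  proof -
    obtain y where y: "y \<in> carrier G" "\<chi> j y \<noteq> \<chi> m y"
      using insert.prems(3)[of j m] j insert.hyps by auto
    \<comment> \<open>The factor that \<open>c i\<close> acquires in the shortened relation: zero at
      \<open>i = m\<close>, and nonzero at \<open>i = j\<close> by the choice of
      \<open>y\<close>.\<close>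
    define d where "d i = \<chi> i y \<oplus> \<ominus> \<chi> m y" for i
    have d: "d i \<in> carrier R" if "i \<in> insert m J" for i
      using that \<chi> y by (simp add: d_def)
    have "\<forall>i\<in>J. c i \<otimes> d i = \<zero>"
    proof (rule insert.IH)
      fix x assume x: "x \<in> carrier G"
      define t where "t i = c i \<otimes> \<chi> i x" for i
      have t: "t i \<in> carrier R" if "i \<in> insert m J" for i
        using that c \<chi> x by (simp add: t_def)
      define T where "T = (\<Oplus>i\<in>J. t i)"
      define U where "U = (\<Oplus>i\<in>J. t i \<otimes> \<chi> i y)"
      have TU: "T \<in> carrier R" "U \<in> carrier R"
        using t \<chi> y by (auto simp: T_def U_def intro!: finsum_closed)
      have my: "\<chi> m y \<in> carrier R" "t m \<in> carrier R"
        using \<chi> y t by auto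
      have "t m \<oplus> T = \<zero>"
        using insert.prems(5)[OF x] insert.hyps t
        unfolding T_def t_def by (subst (asm) finsum_insert) auto
      then have T: "T = \<ominus> t m"
        using my TU by (metis a_comm minus_equality)
      have "(\<Oplus>i\<in>insert m J. t i \<otimes> \<chi> i y) = (\<Oplus>i\<in>insert m J. c i \<otimes> \<chi> i (x \<otimes>\<^bsub>G\<^esub> y))"
        using c \<chi> x y by (intro finsum_cong') (auto simp: t_def \<chi>_mult m_assoc)
      also have "\<dots> = \<zero>"
        using insert.prems(5) x y by simp
      finally have "t m \<otimes> \<chi> m y \<oplus> U = \<zero>"
        using insert.hyps t \<chi> y unfolding U_def by (subst (asm) finsum_insert) auto
      moreover have "(\<Oplus>i\<in>J. c i \<otimes> d i \<otimes> \<chi> i x) = (\<Oplus>i\<in>J. t i \<otimes> \<chi> i y \<oplus> t i \<otimes> \<ominus> \<chi> m y)"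
        using c \<chi> x y d by (intro finsum_cong') (auto simp: t_def d_def r_distr m_ac)
      moreover have "\<dots> = U \<oplus> T \<otimes> \<ominus> \<chi> m y"
        unfolding U_def T_def using insert.hyps t \<chi> y
        by (subst finsum_addf) (auto simp: finsum_ldistr)
      moreover have "T \<otimes> \<ominus> \<chi> m y = t m \<otimes> \<chi> m y"
        unfolding T using my by (simp add: l_minus r_minus)
      ultimately show "(\<Oplus>i\<in>J. c i \<otimes> d i \<otimes> \<chi> i x) = \<zero>"
        using TU my by (simp add: a_comm)
    qed (use insert.prems c d in auto)
    moreover have "d j \<noteq> \<zero>"
      using y \<chi> j by (auto simp: d_def simp flip: minus_eq)
    ultimately show ?thesis
      using j c d integral by blast
  qed
  \<comment> \<open>With the other coefficients zero, evaluation at the unit isolates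
    \<open>c m\<close>.\<close>
  have "(\<Oplus>j\<in>J. c j \<otimes> \<chi> j \<one>\<^bsub>G\<^esub>) = (\<Oplus>j\<in>J. \<zero>)"
    using cJ insert.prems(2) by (intro finsum_cong') auto
  then have "(\<Oplus>j\<in>insert m J. c j \<otimes> \<chi> j \<one>\<^bsub>G\<^esub>) = c m"
    using insert.hyps c insert.prems(2) by (subst finsum_insert) auto
  then have "c m = \<zero>"
    using insert.prems(5)[of "\<one>\<^bsub>G\<^esub>"] c by simp
  then show ?case
    using cJ by simp
qed simp

section \<open>Counting homomorphisms and roots of unity\<close>

lemma (in ring) Span_vanish:
  assumes "subfield E R" and "set Us \<subseteq> carrier R" and "f \<zero> = \<zero>"
    and "\<And>k u v. k \<in> E \<Longrightarrow> u \<in> carrier R \<Longrightarrow> v \<in> carrier R \<Longrightarrow> f (k \<otimes> u \<oplus> v) = k \<otimes> f u \<oplus> f v"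
    and "\<And>u. u \<in> set Us \<Longrightarrow> f u = \<zero>"
    and "v \<in> Span E Us"
  shows "f v = \<zero>"
  using assms(2,5,6)
proof (induction Us arbitrary: v)
  case Nil
  then show ?case using assms(3) by simp
next
  case (Cons u Us)
  obtain k w where "k \<in> E" "w \<in> Span E Us" "v = k \<otimes> u \<oplus> w"
    using Cons.prems by (auto simp: line_extension_mem_iff)
  moreover have "E \<subseteq> carrier R"
    using assms(1) by (rule subfieldE)
  moreover have "w \<in> carrier R"
    using Span_in_carrier[of E Us] calculation Cons.prems by auto
  ultimately show ?case
    using Cons assms(4)[of k u w] by auto
qed

text \<open>With more homomorphisms than basis elements, a nontrivial combination of them would
  vanish on a basis of \<open>L\<close> over \<open>E\<close>, hence on \<open>L\<close> by
  linearity, against Dedekind independence.\<close>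

lemma (in field) card_ring_homs_le_dimension:
  assumes E: "subfield E R" and L: "subfield L R" and dim: "dimension d E L" and fin: "finite J"
    and hom: "\<And>j. j \<in> J \<Longrightarrow> \<chi> j \<in> ring_hom R R"
    and fixed: "\<And>j x. j \<in> J \<Longrightarrow> x \<in> E \<Longrightarrow> \<chi> j x = x"
    and distinct: "\<And>i j. i \<in> J \<Longrightarrow> j \<in> J \<Longrightarrow> i \<noteq> j \<Longrightarrow> \<exists>x\<in>L. \<chi> i x \<noteq> \<chi> j x"
  shows "card J \<le> d"
proof (rule ccontr)
  assume "\<not> card J \<le> d"
  obtain Us where Us: "set Us \<subseteq> carrier R" "independent E Us" "length Us = d" "Span E Us = L"
    using exists_base[OF E dim] by blast
  have EL: "E \<subseteq> carrier R" "L \<subseteq> carrier R"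
    using E L subfieldE(3) by auto
  note \<chi> = ring_hom_memE[OF hom]
  have "card (set Us) < card J"
    using \<open>\<not> card J \<le> d\<close> Us(3) card_length[of Us] by linarith
  then obtain c where c: "c \<in> J \<rightarrow> carrier R" "\<exists>j\<in>J. c j \<noteq> \<zero>"
    and zero: "\<forall>u\<in>set Us. (\<Oplus>j\<in>J. \<chi> j u \<otimes> c j) = \<zero>"
    using homogeneous_system[of "set Us" J "\<lambda>u j. \<chi> j u"] fin Us(1) \<chi>(1) by blast
  have cc: "c j \<in> carrier R" if "j \<in> J" for j
    using c that by auto
  define f where "f v = (\<Oplus>j\<in>J. c j \<otimes> \<chi> j v)" for v
  have f_zero: "f v = \<zero>" if "v \<in> L" for v
  proof (rule Span_vanish[OF E Us(1), where f = f])
    show "v \<in> Span E Us" using that Us by simp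
    have "f \<zero> = (\<Oplus>j\<in>J. \<zero>)"
      unfolding f_def using cc hom by (intro finsum_cong') (auto simp: ring_hom_zero[OF _ ring_axioms ring_axioms])
    then show "f \<zero> = \<zero>" by simp
    have "f u = (\<Oplus>j\<in>J. \<chi> j u \<otimes> c j)" if "u \<in> set Us" for u
      unfolding f_def using cc \<chi>(1) that Us(1) by (intro finsum_cong') (auto simp: m_comm)
    then show "f u = \<zero>" if "u \<in> set Us" for u
      using zero that by auto
    show "f (k \<otimes> u \<oplus> v) = k \<otimes> f u \<oplus> f v"
      if k: "k \<in> E" and u: "u \<in> carrier R" and v: "v \<in> carrier R" for k u v
    proof -
      have kc: "k \<in> carrier R" using k EL by auto
      have "f (k \<otimes> u \<oplus> v) = (\<Oplus>j\<in>J. k \<otimes> (c j \<otimes> \<chi> j u) \<oplus> c j \<otimes> \<chi> j v)"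
        unfolding f_def using cc \<chi> u v kc k fixed
        by (intro finsum_cong') (auto simp: r_distr m_ac)
      also have "\<dots> = k \<otimes> f u \<oplus> f v"
        unfolding f_def using cc \<chi>(1) u v kc fin
        by (subst finsum_addf) (auto simp: finsum_rdistr)
      finally show ?thesis .
    qed
  qed
  interpret L: field "R\<lparr>carrier := L\<rparr>"
    using subfield_iff(2)[OF L] .
  have "\<forall>j\<in>J. c j = \<zero>"
  proof (rule dedekind_independence)
    show "monoid (R\<lparr>carrier := L\<rparr>)" by (rule L.monoid_axioms)
    show "\<chi> j \<in> hom (R\<lparr>carrier := L\<rparr>) R" if "j \<in> J" for j
      using \<chi>[OF that] EL by (auto simp: hom_def subset_iff)
    show "(\<Oplus>j\<in>J. c j \<otimes> \<chi> j x) = \<zero>" if "x \<in> carrier (R\<lparr>carrier := L\<rparr>)" for x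
      using f_zero[of x] that by (simp add: f_def)
  qed (use fin \<chi>(4) distinct cc in auto)
  then show False
    using c(2) by blast
qed

text \<open>A further root would give \<open>p + 1\<close> distinct characters of the additive
  naturals. Some nontrivial combination kills the \<open>p\<close> exponents below \<open>p\<close>,
  hence all by periodicity, against independence.\<close>

lemma (in field) root_of_unity_is_power:
  fixes p :: nat
  assumes "\<xi> \<in> carrier R" and "\<xi> [^] p = \<one>" and "z \<in> carrier R" and "z [^] p = \<one>"
    and distinct: "\<And>i j. i < p \<Longrightarrow> j < p \<Longrightarrow> \<xi> [^] i = \<xi> [^] j \<Longrightarrow> i = j"
    and "p > 0"
  shows "\<exists>j::nat. z = \<xi> [^] j"
proof (rule ccontr)
  assume not: "\<nexists>j::nat. z = \<xi> [^] j"
  \<comment> \<open>The index \<open>p\<close> carries the supposed extra root.\<close>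
  define w where "w i = (if i = p then z else \<xi> [^] i)" for i
  have w: "w i \<in> carrier R" for i
    using assms by (simp add: w_def)
  have w_pow: "w i [^] p = \<one>" for i
    using assms by (simp add: w_def nat_pow_pow mult.commute[of _ p] flip: nat_pow_pow[of _ p])
  have w_inj: "w i \<noteq> w j" if "i \<le> p" "j \<le> p" "i \<noteq> j" for i j
    using that distinct[of i j] not by (auto simp: w_def split: if_splits)
  obtain c where c: "c \<in> {..p} \<rightarrow> carrier R" "\<exists>i\<in>{..p}. c i \<noteq> \<zero>"
    and zero: "\<forall>a\<in>{..<p}. (\<Oplus>i\<in>{..p}. w i [^] a \<otimes> c i) = \<zero>"
    using homogeneous_system[of "{..<p}" "{..p}" "\<lambda>a i. w i [^] a"] w by auto
  let ?G = "\<lparr>carrier = UNIV, monoid.mult = (+), one = 0\<rparr> :: nat monoid"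
  have w_mod: "w i [^] a = w i [^] (a mod p)" for i a :: nat
  proof -
    have "w i [^] a = w i [^] (p * (a div p) + a mod p)" by simp
    also have "\<dots> = (w i [^] p) [^] (a div p) \<otimes> w i [^] (a mod p)"
      by (simp only: nat_pow_mult nat_pow_pow w)
    finally show ?thesis
      using w w_pow by simp
  qed
  have "\<forall>i\<in>{..p}. c i = \<zero>"
  proof (rule dedekind_independence[where G = ?G and \<chi> = "\<lambda>i a. w i [^] (a::nat)"])
    show "monoid ?G" by unfold_locales auto
    show "(\<lambda>a::nat. w i [^] a) \<in> hom ?G R" for i
      using w by (auto simp: hom_def nat_pow_mult)
    show "\<exists>a\<in>carrier ?G. w i [^] (a::nat) \<noteq> w j [^] a" if "i \<in> {..p}" "j \<in> {..p}" "i \<noteq> j" for i j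
      using w_inj[of i j] that w by (intro bexI[of _ "1::nat"]) auto
    show "(\<Oplus>i\<in>{..p}. c i \<otimes> w i [^] a) = \<zero>" for a :: nat
    proof -
      have "(\<Oplus>i\<in>{..p}. c i \<otimes> w i [^] a) = (\<Oplus>i\<in>{..p}. w i [^] (a mod p) \<otimes> c i)"
        using w c w_mod[of _ a] by (intro finsum_cong') (auto simp: m_comm Pi_iff)
      then show ?thesis
        using zero \<open>p > 0\<close> by simp
    qed
  qed (use c in auto)
  then show False
    using c(2) by blast
qed

section \<open>Automorphisms of finite order\<close>

abbreviation (input) units_group :: "('a, 'b) ring_scheme \<Rightarrow> 'a monoid" where
  "units_group R \<equiv> Multiplicative_Group.mult_of R"

definition fixed_field :: "('a, 'b) ring_scheme \<Rightarrow> ('a \<Rightarrow> 'a) \<Rightarrow> 'a set" where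
  "fixed_field R \<tau> = {x \<in> carrier R. \<tau> x = x}"

lemma (in ring) funpow_ring_hom: "\<tau> \<in> ring_hom R R \<Longrightarrow> \<tau> ^^ j \<in> ring_hom R R"
  by (induction j) (auto simp: ring_hom_def Pi_iff)

lemma (in field) subfield_fixed_field:
  assumes "\<tau> \<in> ring_hom R R"
  shows "subfield (fixed_field R \<tau>) R"
proof (rule subfieldI')
  note \<tau> = ring_hom_memE[OF assms]
  have uminus: "\<tau> (\<ominus> x) = \<ominus> x" if "x \<in> carrier R" "\<tau> x = x" for x
  proof -
    have "\<tau> (\<ominus> x) \<oplus> x = \<zero>"
      using \<tau>(3)[of "\<ominus> x" x] that ring_hom_zero[OF assms] ring_axioms by (simp add: l_neg)
    then show ?thesis
      using that \<tau>(1) by (metis a_inv_closed minus_equality)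
  qed
  show "subring (fixed_field R \<tau>) R"
    using \<tau> uminus by (intro subringI) (auto simp: fixed_field_def)
  show "inv k \<in> fixed_field R \<tau>" if "k \<in> fixed_field R \<tau> - {\<zero>}" for k
  proof -
    have k: "k \<in> carrier R" "\<tau> k = k" "k \<in> Units R"
      using that field_Units by (auto simp: fixed_field_def)
    then have "k \<otimes> \<tau> (inv k) = \<one>"
      using \<tau>(2)[of k "inv k"] \<tau>(4) by simp
    then have "\<tau> (inv k) = inv k"
      using k \<tau>(1) by (metis Units_inv_closed comm_inv_char)
    then show ?thesis
      using k by (simp add: fixed_field_def)
  qed
qed

lemma (in field) ring_hom_inj:
  assumes "h \<in> ring_hom R R" "x \<in> carrier R" "y \<in> carrier R" "h x = h y"
  shows "x = y"
proof (rule ccontr)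
  assume "x \<noteq> y"
  note h = ring_hom_memE[OF assms(1)]
  define z where "z = x \<oplus> \<ominus> y"
  have z: "z \<in> carrier R" "z \<in> Units R"
    using assms \<open>x \<noteq> y\<close> field_Units by (auto simp: z_def simp flip: minus_eq)
  have "h z \<oplus> h y = h x"
    using assms h(3)[of z y] by (simp add: z_def a_assoc l_neg)
  then have "h z = \<zero>"
    using assms(2-4) h(1) z by (metis add.l_cancel_one' a_comm)
  then have "h (z \<otimes> inv z) = \<zero>"
    using h(1)[of "inv z"] h(2)[of z "inv z"] z by (simp del: Units_r_inv)
  then show False
    using h(4) z by simp
qed

lemma (in cring) ring_hom_finsum:
  assumes "h \<in> ring_hom R R" "f \<in> A \<rightarrow> carrier R"
  shows "h (\<Oplus>i\<in>A. f i) = (\<Oplus>i\<in>A. h (f i))"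
proof -
  interpret ring_hom_cring R R h
    using assms(1) by unfold_locales
  show ?thesis
    using hom_finsum[OF assms(2)] by (simp add: o_def)
qed

lemma (in ring) combine_map:
  assumes "distinct us" "set us \<subseteq> carrier R" "f \<in> set us \<rightarrow> carrier R"
  shows "combine (map f us) us = (\<Oplus>u\<in>set us. f u \<otimes> u)"
  using assms by (induction us) (auto simp: Pi_iff subset_iff)

text \<open>An independent list of maximal length spans, since any vector outside its span would
  extend it.\<close>

lemma (in ring) dimension_of_bounded:
  assumes "subfield E R" and "\<And>us. independent E us \<Longrightarrow> length us \<le> m"
  shows "\<exists>d\<le>m. dimension d E (carrier R)"
proof -
  obtain us where us: "independent E us" "\<And>vs. independent E vs \<Longrightarrow> length vs \<le> length us"
    using ex_has_greatest_nat[of "independent E" "[]" length "Suc m"] assms(2)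
    by (auto simp: less_Suc_eq_le)
  have "u \<in> Span E us" if "u \<in> carrier R" for u
    using us(2)[of "u # us"] li_Cons[OF that _ us(1)] by auto
  moreover have "Span E us \<subseteq> carrier R"
    using Span_in_carrier[OF subfieldE(3)[OF assms(1)]] independent_in_carrier[OF us(1)] by simp
  ultimately have "Span E us = carrier R"
    by blast
  then show ?thesis
    using dimension_independent[OF us(1)] assms(2)[OF us(1)] by auto
qed

text \<open>Here \<open>\<tau>\<close> need not be extensional: only its values on the carrier are
  constrained, so its powers are plain iterates. They are restricted to the carrier only when
  compared with \<open>Gal\<close>.\<close>

locale cyclic_automorphism = field R for R (structure) +
  fixes \<tau> :: "'a \<Rightarrow> 'a" and m :: nat
  assumes hom: "\<tau> \<in> ring_hom R R" and m_pos: "m > 0"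
    and period: "x \<in> carrier R \<Longrightarrow> (\<tau> ^^ m) x = x"
    and minimal: "0 < j \<Longrightarrow> j < m \<Longrightarrow> \<exists>x\<in>carrier R. (\<tau> ^^ j) x \<noteq> x"
begin

abbreviation "E \<equiv> fixed_field R \<tau>"

lemma subfield_E: "subfield E R"
  by (rule subfield_fixed_field) (rule hom)

lemmas funpow_hom = funpow_ring_hom[OF hom]
lemmas funpow_hom_simps [simp] = ring_hom_memE[OF funpow_hom]

lemma funpow_mod: "x \<in> carrier R \<Longrightarrow> (\<tau> ^^ (j mod m)) x = (\<tau> ^^ j) x"
proof -
  assume x: "x \<in> carrier R"
  have "((\<tau> ^^ m) ^^ t) x = x" for t
    using x period by (induction t) simp_all
  then have "(\<tau> ^^ (j mod m)) ((\<tau> ^^ (m * (j div m))) x) = (\<tau> ^^ (j mod m)) x"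
    by (simp add: funpow_mult)
  then show ?thesis
    by (metis comp_apply funpow_add mod_mult_div_eq)
qed

lemma funpow_fixed_E: "x \<in> E \<Longrightarrow> (\<tau> ^^ j) x = x"
  by (induction j) (auto simp: fixed_field_def)

lemma funpow_distinct:
  assumes "i < m" "j < m" "i \<noteq> j"
  shows "\<exists>x\<in>carrier R. (\<tau> ^^ i) x \<noteq> (\<tau> ^^ j) x"
  using assms
proof (induction i j rule: linorder_wlog)
  case (le i j)
  then obtain x where x: "x \<in> carrier R" "(\<tau> ^^ (j - i)) x \<noteq> x"
    using minimal[of "j - i"] by (metis diff_less_Suc diff_is_0_eq le_neq_implies_less less_imp_diff_less less_nat_zero_code
        linorder_not_le zero_less_diff)
  have "(\<tau> ^^ j) x = (\<tau> ^^ i) ((\<tau> ^^ (j - i)) x)"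
    using le by (simp flip: funpow_add[unfolded o_def, THEN fun_cong])
  then show ?case
    using x ring_hom_inj[OF funpow_hom[of i], of x "(\<tau> ^^ (j - i)) x"]
    by (metis funpow_hom_simps(1))
next
  case (sym i j)
  then show ?case by metis
qed

lemma funpow_independent:
  assumes "\<And>j. j < m \<Longrightarrow> c j \<in> carrier R"
    and "\<And>x. x \<in> carrier R \<Longrightarrow> (\<Oplus>j\<in>{..<m}. c j \<otimes> (\<tau> ^^ j) x) = \<zero>"
  shows "\<forall>j<m. c j = \<zero>"
  using dedekind_independence[of R "{..<m}" "\<lambda>j. \<tau> ^^ j" c] assms funpow_distinct monoid_axioms
  by (auto simp: hom_def)

section \<open>The trace and the degree over the fixed field\<close>

definition trace :: "'a \<Rightarrow> 'a" where
  "trace x = (\<Oplus>j\<in>{..<m}. (\<tau> ^^ j) x)"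

text \<open>Applying \<open>\<tau>\<close> shifts the summands by one, and periodicity makes the
  shift cyclic.\<close>

lemma trace_in_E:
  assumes "x \<in> carrier R" shows "trace x \<in> E"
proof -
  obtain m' where m: "m = Suc m'"
    using m_pos gr0_conv_Suc by auto
  define s where "s = (\<Oplus>j\<in>{..m'}. (\<tau> ^^ Suc j) x)"
  have s: "s \<in> carrier R"
    unfolding s_def using assms by (intro finsum_closed) (auto simp del: funpow.simps)
  have tr: "trace x = (\<Oplus>j\<in>{..m'}. (\<tau> ^^ j) x)"
    unfolding trace_def by (simp add: m lessThan_Suc_atMost)
  have trc: "trace x \<in> carrier R"
    unfolding trace_def using assms by (intro finsum_closed) auto
  have "\<tau> (trace x) = s"
    unfolding tr s_def using assms by (subst ring_hom_finsum[OF hom]) auto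
  moreover have "x \<oplus> trace x = (\<Oplus>j\<in>{..Suc m'}. (\<tau> ^^ j) x)"
    unfolding tr using assms period[of x] by (simp add: m)
  moreover have "\<dots> = s \<oplus> x"
    unfolding s_def using assms by (subst finsum_Suc2) auto
  ultimately show ?thesis
    using assms s trc by (simp add: fixed_field_def a_comm[of x])
qed

lemma trace_nonzero: "\<exists>y\<in>carrier R. trace y \<noteq> \<zero>"
proof (rule ccontr)
  assume "\<not> (\<exists>y\<in>carrier R. trace y \<noteq> \<zero>)"
  then have "(\<Oplus>j\<in>{..<m}. \<one> \<otimes> (\<tau> ^^ j) x) = \<zero>" if "x \<in> carrier R" for x
    using that by (auto simp: trace_def cong: finsum_cong)
  then have "\<forall>j<m. \<one> = \<zero>"
    by (intro funpow_independent) auto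
  then show False
    using m_pos by auto
qed

text \<open>Artin's bound. For too many vectors \<open>u\<close> a linear system gives coefficients
  that annihilate all their conjugates; moving \<open>\<tau>\<close> onto the coefficients and
  summing over its powers yields a relation with traces, which lie in \<open>E\<close>, as
  coefficients.\<close>

lemma independent_length_le_order:
  assumes "independent E us"
  shows "length us \<le> m"
proof (rule ccontr)
  assume "\<not> length us \<le> m"
  moreover have dist: "distinct us"
    using independent_distinct[OF subfield_E assms] .
  ultimately have "card {..<m} < card (set us)"
    by (simp add: distinct_card)
  have us: "u \<in> carrier R" if "u \<in> set us" for u
    using independent_in_carrier[OF assms] that by auto
  obtain x where x: "x \<in> set us \<rightarrow> carrier R" "\<exists>u\<in>set us. x u \<noteq> \<zero>"
    and zero: "\<forall>i\<in>{..<m}. (\<Oplus>u\<in>set us. (\<tau> ^^ i) u \<otimes> x u) = \<zero>"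
    using homogeneous_system[of "{..<m}" "set us" "\<lambda>i u. (\<tau> ^^ i) u"] us
      \<open>card {..<m} < card (set us)\<close> by auto
  obtain u0 where u0: "u0 \<in> set us" "x u0 \<noteq> \<zero>"
    using x by blast
  obtain y where y: "y \<in> carrier R" "trace y \<noteq> \<zero>"
    using trace_nonzero by blast
  \<comment> \<open>The solution is rescaled to take the value \<open>y\<close> at
    \<open>u0\<close>, so that one of the resulting traces is nonzero.\<close>
  define z where "z u = y \<otimes> inv (x u0) \<otimes> x u" for u
  have x0: "x u0 \<in> Units R"
    using x u0 by (auto simp: field_Units)
  have z: "z u \<in> carrier R" if "u \<in> set us" for u
    using x that y x0 by (auto simp: z_def)
  have z0: "z u0 = y"
    using x0 y by (simp add: z_def m_assoc Units_closed)
  have zero_z: "(\<Oplus>u\<in>set us. (\<tau> ^^ i) u \<otimes> z u) = \<zero>" if "i < m" for i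
  proof -
    have "(\<Oplus>u\<in>set us. (\<tau> ^^ i) u \<otimes> z u) = (\<Oplus>u\<in>set us. y \<otimes> inv (x u0) \<otimes> ((\<tau> ^^ i) u \<otimes> x u))"
      unfolding z_def using us x y x0 by (intro finsum_cong') (auto simp: m_ac Pi_iff)
    also have "\<dots> = y \<otimes> inv (x u0) \<otimes> (\<Oplus>u\<in>set us. (\<tau> ^^ i) u \<otimes> x u)"
      using us x y x0 by (subst finsum_rdistr) (auto simp: Pi_iff)
    finally show ?thesis
      using zero that y x0 by simp
  qed
  have zero_\<tau>: "(\<Oplus>u\<in>set us. u \<otimes> (\<tau> ^^ j) (z u)) = \<zero>" if "j < m" for j
  proof -
    \<comment> \<open>The exponent inverse to \<open>j\<close> modulo \<open>m\<close>: applying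
      \<open>\<tau> ^^ j\<close> to equation \<open>i\<close> then frees \<open>u\<close> of any
      conjugation.\<close>
    define i where "i = (m - j) mod m"
    have i: "i < m" "(j + i) mod m = 0"
      using that m_pos by (auto simp: i_def mod_add_right_eq)
    have "\<zero> = (\<tau> ^^ j) (\<Oplus>u\<in>set us. (\<tau> ^^ i) u \<otimes> z u)"
      using zero_z[OF i(1)] ring_hom_zero[OF funpow_hom[of j]] ring_axioms by simp
    also have "\<dots> = (\<Oplus>u\<in>set us. (\<tau> ^^ j) ((\<tau> ^^ i) u \<otimes> z u))"
      using us z by (intro ring_hom_finsum funpow_hom) auto
    also have "\<dots> = (\<Oplus>u\<in>set us. u \<otimes> (\<tau> ^^ j) (z u))"
    proof (rule finsum_cong')
      show "(\<tau> ^^ j) ((\<tau> ^^ i) u \<otimes> z u) = u \<otimes> (\<tau> ^^ j) (z u)" if "u \<in> set us" for u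
        using us[OF that] z[OF that] funpow_mod[of u "j + i"] i(2) by (simp add: funpow_add)
    qed (use us z in auto)
    finally show ?thesis by simp
  qed
  have "(\<Oplus>u\<in>set us. (\<Oplus>j\<in>{..<k}. (\<tau> ^^ j) (z u)) \<otimes> u) = \<zero>" if "k \<le> m" for k
    using that
  proof (induction k)
    case 0
    have "(\<Oplus>u\<in>set us. \<zero> \<otimes> u) = (\<Oplus>u\<in>set us. \<zero>)"
      using us by (intro finsum_cong') auto
    then show ?case by simp
  next
    case (Suc k)
    have c: "(\<Oplus>j\<in>{..<k}. (\<tau> ^^ j) (z u)) \<in> carrier R" if "u \<in> set us" for u
      using that z by (intro finsum_closed) auto
    have "(\<Oplus>u\<in>set us. (\<Oplus>j\<in>{..<Suc k}. (\<tau> ^^ j) (z u)) \<otimes> u) =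
        (\<Oplus>u\<in>set us. u \<otimes> (\<tau> ^^ k) (z u) \<oplus> (\<Oplus>j\<in>{..<k}. (\<tau> ^^ j) (z u)) \<otimes> u)"
      using us z c by (intro finsum_cong') (auto simp: lessThan_Suc l_distr r_distr m_comm Pi_iff)
    also have "\<dots> = \<zero>"
      using us z c Suc zero_\<tau>[of k] by (subst finsum_addf) auto
    finally show ?case .
  qed
  from this[of m] have sum: "(\<Oplus>u\<in>set us. trace (z u) \<otimes> u) = \<zero>"
    by (simp add: trace_def)
  have tr: "trace (z u) \<in> E" if "u \<in> set us" for u
    using that z trace_in_E by blast
  have EC: "E \<subseteq> carrier R"
    by (auto simp: fixed_field_def)
  have "combine (map (\<lambda>u. trace (z u)) us) us = \<zero>"
    using combine_map[OF dist, of "\<lambda>u. trace (z u)"] us tr EC sum by auto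
  then have "set (take (length us) (map (\<lambda>u. trace (z u)) us)) \<subseteq> {\<zero>}"
    using tr by (intro independent_imp_trivial_combine[OF subfield_E assms]) auto
  then have "trace (z u0) = \<zero>"
    using u0 by auto
  then show False
    using z0 y by simp
qed

text \<open>The upper bound is Artin's; the lower bound counts the \<open>m\<close> distinct powers
  of \<open>\<tau>\<close>.\<close>

lemma dimension_E: "dimension m E (carrier R)"
proof -
  obtain d where d: "d \<le> m" "dimension d E (carrier R)"
    using dimension_of_bounded[OF subfield_E, of m] independent_length_le_order by blast
  have "card {..<m} \<le> d"
  proof (rule card_ring_homs_le_dimension[OF subfield_E carrier_is_subfield d(2)])
    show "\<tau> ^^ j \<in> ring_hom R R" for j by (rule funpow_hom)
    show "(\<tau> ^^ j) x = x" if "x \<in> E" for j x using that by (rule funpow_fixed_E)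
    show "\<exists>x\<in>carrier R. (\<tau> ^^ i) x \<noteq> (\<tau> ^^ j) x" if "i \<in> {..<m}" "j \<in> {..<m}" "i \<noteq> j" for i j
      using that by (intro funpow_distinct) auto
  qed simp
  then show ?thesis
    using d by simp
qed

text \<open>Otherwise \<open>g\<close> and the powers of \<open>\<tau>\<close> would be
  \<open>m + 1\<close> distinct homomorphisms over a subfield of degree \<open>m\<close>.\<close>

lemma ring_hom_eq_funpow:
  assumes g: "g \<in> ring_hom R R" "\<And>x. x \<in> E \<Longrightarrow> g x = x"
  shows "\<exists>j<m. \<forall>x\<in>carrier R. g x = (\<tau> ^^ j) x"
proof (rule ccontr)
  assume not: "\<not> (\<exists>j<m. \<forall>x\<in>carrier R. g x = (\<tau> ^^ j) x)"
  \<comment> \<open>The powers of \<open>\<tau>\<close> occupy the indices below \<open>m\<close>,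
    and \<open>g\<close> takes the index \<open>m\<close>.\<close>
  define \<chi> where "\<chi> j = (if j = m then g else \<tau> ^^ j)" for j
  have "card {..m} \<le> m"
  proof (rule card_ring_homs_le_dimension[OF subfield_E carrier_is_subfield dimension_E])
    show "\<chi> j \<in> ring_hom R R" for j
      using g funpow_hom by (simp add: \<chi>_def)
    show "\<chi> j x = x" if "x \<in> E" for j x
      using that g funpow_fixed_E by (simp add: \<chi>_def)
    show "\<exists>x\<in>carrier R. \<chi> i x \<noteq> \<chi> j x" if "i \<in> {..m}" "j \<in> {..m}" "i \<noteq> j" for i j
    proof (cases "i = m \<or> j = m")
      case True
      define k where "k = min i j"
      have "k < m"
        using True that by (auto simp: k_def)
      then obtain x where "x \<in> carrier R" "g x \<noteq> (\<tau> ^^ k) x"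
        using not by blast
      then show ?thesis
        using True that by (intro bexI[of _ x]) (auto simp: \<chi>_def k_def min_def split: if_splits)
    next
      case False
      then show ?thesis
        using that funpow_distinct[of i j] by (auto simp: \<chi>_def)
    qed
  qed simp
  then show False by simp
qed

section \<open>Hilbert 90 for the unit group\<close>

lemma nonzero_funpow:
  assumes "x \<in> carrier R" "x \<noteq> \<zero>" shows "(\<tau> ^^ j) x \<noteq> \<zero>"
  using ring_hom_inj[OF funpow_hom[of j], of x \<zero>] assms
    ring_hom_zero[OF funpow_hom[of j] ring_axioms ring_axioms] by auto

sublocale units: comm_group_endo "units_group R" \<tau>
proof (intro comm_group_endo.intro comm_group_endo_axioms.intro)
  show "comm_group (units_group R)"
    by (rule group.group_comm_groupI[OF field_mult_group]) (auto simp: m_comm)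
  show "\<tau> \<in> Group.hom (units_group R) (units_group R)"
    using ring_hom_memE[OF hom] nonzero_funpow[of _ 1] by (auto simp: Group.hom_def)
qed

text \<open>By independence some resolvent \<open>a\<close>, the sum of
  \<open>?N j \<otimes> (\<tau> ^^ j) c\<close>, is nonzero. It satisfies
  \<open>u \<otimes> \<tau> a = a\<close>, so the inverse of \<open>a\<close> is the required
  \<open>\<theta>\<close>.\<close>

theorem hilbert90:
  assumes u: "u \<in> carrier (units_group R)" and norm: "orbit_prod (units_group R) \<tau> m u = \<one>"
  shows "\<exists>\<theta>\<in>carrier (units_group R). \<tau> \<theta> = \<theta> \<otimes> u"
proof -
  let ?N = "\<lambda>j. orbit_prod (units_group R) \<tau> j u"
  have N: "?N j \<in> carrier R" "?N j \<noteq> \<zero>" for j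
    using units.N_closed[OF u, of j] by auto
  have uc: "u \<in> carrier R" using u by simp
  have "\<not> (\<forall>x\<in>carrier R. (\<Oplus>j\<in>{..<m}. ?N j \<otimes> (\<tau> ^^ j) x) = \<zero>)"
    using funpow_independent[of ?N] N m_pos by blast
  then obtain c where c: "c \<in> carrier R" "(\<Oplus>j\<in>{..<m}. ?N j \<otimes> (\<tau> ^^ j) c) \<noteq> \<zero>"
    by blast
  define f where "f j = ?N j \<otimes> (\<tau> ^^ j) c" for j
  have f: "f j \<in> carrier R" for j
    using N c by (simp add: f_def)
  note \<tau> = ring_hom_memE[OF hom]
  obtain m' where m: "m = Suc m'"
    using m_pos gr0_conv_Suc by auto
  define a where "a = (\<Oplus>j\<in>{..m'}. f j)"
  have "a \<noteq> \<zero>"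
    using c(2) unfolding a_def f_def m lessThan_Suc_atMost .
  moreover have "a \<in> carrier R"
    using f by (auto simp: a_def)
  ultimately have a: "a \<in> carrier (units_group R)" "a \<in> carrier R"
    by auto
  have step: "f (Suc j) = u \<otimes> \<tau> (f j)" for j
  proof -
    have 1: "\<tau> (?N j) \<otimes> u = ?N (Suc j)"
      using units.endo_N[OF u, of j] by simp
    have "f (Suc j) = ?N (Suc j) \<otimes> \<tau> ((\<tau> ^^ j) c)"
      unfolding f_def by (simp only: funpow.simps o_apply)
    also have "\<dots> = u \<otimes> (\<tau> (?N j) \<otimes> \<tau> ((\<tau> ^^ j) c))"
      unfolding 1[symmetric] using \<tau>(1)[OF N(1)[of j]] \<tau>(1)[of "(\<tau> ^^ j) c"] c uc
      by (simp add: m_ac)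
    also have "\<dots> = u \<otimes> \<tau> (f j)"
      unfolding f_def using N(1)[of j] c by (subst \<tau>(2)) simp_all
    finally show ?thesis .
  qed
  have "(\<Oplus>j\<in>{..m'}. f (Suc j)) = u \<otimes> \<tau> a"
    unfolding a_def step using f uc \<tau>(1)
    by (subst ring_hom_finsum[OF hom]) (auto simp: finsum_rdistr)
  \<comment> \<open>The only use of the trivial norm: after \<open>m\<close> steps the summands
    return to the first one.\<close>
  moreover have "f (Suc m') = f 0"
    using norm period[OF c(1)] unfolding f_def m by simp
  moreover have "f (Suc m') \<oplus> a = (\<Oplus>j\<in>{..m'}. f (Suc j)) \<oplus> f 0"
    using f finsum_Suc[of f m'] finsum_Suc2[of f m'] by (simp add: a_def)
  ultimately have eq: "u \<otimes> \<tau> a = a"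
    using a f \<tau>(1) uc by (simp add: a_comm[of "f 0"])
  let ?b = "inv\<^bsub>units_group R\<^esub> a"
  have "?b \<otimes>\<^bsub>units_group R\<^esub> u \<otimes>\<^bsub>units_group R\<^esub> \<tau> a = \<one>\<^bsub>units_group R\<^esub>"
    using u a eq units.m_assoc[of ?b u "\<tau> a"] units.l_inv[OF a(1)] units.endo_closed[OF a(1)]
      units.inv_closed[OF a(1)] by simp
  then have "\<tau> ?b = ?b \<otimes>\<^bsub>units_group R\<^esub> u"
    using a u units.inv_closed[OF a(1)] units.endo_closed[OF a(1)]
    by (metis units.endo_inv units.inv_equality units.m_closed)
  then show ?thesis
    using units.inv_closed[OF a(1)] by (intro bexI[of _ ?b]) (simp_all add: Multiplicative_Group.mult_mult_of)
qed

end

section \<open>Galois groups and intermediate fields\<close>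

lemma orbit_prod_units_group [simp]:
  "orbit_prod (units_group R) \<tau> m x = orbit_prod R \<tau> m x"
  by (induction m) simp_all

lemma orbit_prod_carrier_update [simp]:
  "orbit_prod (R\<lparr>carrier := L\<rparr>) \<tau> m x = orbit_prod R \<tau> m x"
  by (induction m) simp_all

context cyclic_automorphism
begin

lemma funpow_in_Gal: "restrict (\<tau> ^^ j) (carrier R) \<in> carrier (Gal R E)"
proof -
  have inj: "inj_on (\<tau> ^^ j) (carrier R)"
    using ring_hom_inj[OF funpow_hom] by (auto intro!: inj_onI)
  have "y \<in> (\<tau> ^^ j) ` carrier R" if "y \<in> carrier R" for y
  proof
    have "(j + (m - j mod m)) mod m = 0"
      using m_pos by (metis le_add_diff_inverse less_imp_le_nat mod_add_left_eq mod_less_divisor mod_self)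
    then show "y = (\<tau> ^^ j) ((\<tau> ^^ (m - j mod m)) y)"
      using funpow_mod[OF that, of "j + (m - j mod m)"] by (simp add: funpow_add)
  qed (use that in simp)
  then have "bij_betw (\<tau> ^^ j) (carrier R) (carrier R)"
    using inj by (auto simp: bij_betw_def)
  then have "restrict (\<tau> ^^ j) (carrier R) \<in> Bij (carrier R)"
    by (simp add: Bij_def cong: bij_betw_cong)
  moreover have "restrict (\<tau> ^^ j) (carrier R) \<in> ring_hom R R"
    by (auto simp: ring_hom_def)
  ultimately show ?thesis
    using funpow_fixed_E by (auto simp: Gal_def fixed_field_def)
qed

text \<open>Agreement with a power of \<open>\<tau>\<close> on the carrier becomes equality because
  elements of \<open>Gal\<close> are extensional.\<close>

lemma carrier_Gal: "carrier (Gal R E) = (\<lambda>j. restrict (\<tau> ^^ j) (carrier R)) ` {..<m}"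
proof
  show "carrier (Gal R E) \<subseteq> (\<lambda>j. restrict (\<tau> ^^ j) (carrier R)) ` {..<m}"
  proof
    fix g assume "g \<in> carrier (Gal R E)"
    then have g: "g \<in> ring_hom R R" "g \<in> Bij (carrier R)" "\<And>x. x \<in> E \<Longrightarrow> g x = x"
      by (auto simp: Gal_def)
    then obtain j where j: "j < m" "\<forall>x\<in>carrier R. g x = (\<tau> ^^ j) x"
      using ring_hom_eq_funpow by blast
    then have "g = restrict (\<tau> ^^ j) (carrier R)"
      using Bij_imp_extensional[OF g(2)] by (intro extensionalityI[of _ "carrier R"]) auto
    then show "g \<in> (\<lambda>j. restrict (\<tau> ^^ j) (carrier R)) ` {..<m}"
      using j by auto
  qed
qed (use funpow_in_Gal in auto)

lemma field_norm_eq_orbit_prod: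
  assumes x: "x \<in> carrier R"
  shows "field_norm R E x = orbit_prod R \<tau> m x"
proof -
  have inj: "inj_on (\<lambda>j. restrict (\<tau> ^^ j) (carrier R)) {..<m}"
  proof (rule inj_onI, rule ccontr)
    fix i j
    assume ij: "i \<in> {..<m}" "j \<in> {..<m}" "i \<noteq> j"
      and eq: "restrict (\<tau> ^^ i) (carrier R) = restrict (\<tau> ^^ j) (carrier R)"
    obtain y where "y \<in> carrier R" "(\<tau> ^^ i) y \<noteq> (\<tau> ^^ j) y"
      using funpow_distinct[of i j] ij by auto
    then show False
      using fun_cong[OF eq, of y] by simp
  qed
  have "finprod R (\<lambda>j. (\<tau> ^^ j) x) {..<k} = orbit_prod R \<tau> k x" for k
  proof (induction k)
    case (Suc k)
    then show ?case
      using x by (simp add: lessThan_Suc m_comm flip: Suc)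
  qed simp
  moreover have "field_norm R E x = finprod R (\<lambda>j. restrict (\<tau> ^^ j) (carrier R) x) {..<m}"
    unfolding field_norm_def carrier_Gal using inj x by (subst finprod_reindex) auto
  ultimately show ?thesis
    using x by simp
qed

text \<open>Makes the degree, Galois group, norm and Hilbert 90 results available over every
  intermediate field.\<close>

lemma cyclic_automorphism_funpow:
  assumes "h dvd m"
  shows "cyclic_automorphism R (\<tau> ^^ h) (m div h)"
proof unfold_locales
  have h: "h * (m div h) = m" "h > 0"
    using assms m_pos by (auto intro: Nat.gr0I)
  show "\<tau> ^^ h \<in> ring_hom R R"
    by (rule funpow_hom)
  show "0 < m div h"
    using h m_pos by (metis gr0I mult_0_right)
  show "((\<tau> ^^ h) ^^ (m div h)) x = x" if "x \<in> carrier R" for x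
    using period[OF that] h by (simp add: funpow_mult)
  show "\<exists>x\<in>carrier R. ((\<tau> ^^ h) ^^ j) x \<noteq> x" if "0 < j" "j < m div h" for j
    using minimal[of "h * j"] that h by (metis funpow_mult mult.commute mult_less_cancel1 nat_0_less_mult_iff)
qed

lemma E_subset_fixed_field: "E \<subseteq> fixed_field R (\<tau> ^^ h)"
  using funpow_fixed_E by (auto simp: fixed_field_def)

lemma subfield_fixed_funpow: "subfield (fixed_field R (\<tau> ^^ h)) R"
  by (rule subfield_fixed_field) (rule funpow_hom)

section \<open>The Galois correspondence for a cyclic group\<close>

text \<open>Tower law: the field has degree \<open>m\<close> over \<open>E\<close> and degree
  \<open>m div h\<close> over the fixed field of \<open>\<tau> ^^ h\<close>.\<close>

lemma dimension_fixed_funpow: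
  assumes "h dvd m"
  shows "dimension h E (fixed_field R (\<tau> ^^ h))"
proof -
  interpret h: cyclic_automorphism R "\<tau> ^^ h" "m div h"
    using assms by (rule cyclic_automorphism_funpow)
  have "subalgebra E h.E R"
  proof (intro subalgebra.intro subalgebra_axioms.intro)
    show "subgroup h.E (add_monoid R)"
      using subfieldE(1)[OF h.subfield_E] subring.axioms(1) by blast
    show "k \<otimes> v \<in> h.E" if "k \<in> E" "v \<in> h.E" for k v
      using that E_subset_fixed_field[of h] subringE(6)[OF subfieldE(1)[OF h.subfield_E]] by blast
  qed
  then have "finite_dimension E h.E"
    using subalbegra_incl_imp_finite_dimension[OF subfield_E finite_dimensionI[OF dimension_E]]
    by (auto simp: fixed_field_def)
  then obtain d where d: "dimension d E h.E"
    by blast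
  have "d * (m div h) = m"
    using dimension_is_inj[OF subfield_E telescopic_base[OF subfield_E h.subfield_E d h.dimension_E] dimension_E] .
  then have "d = h"
    using assms m_pos by (metis dvd_mult_div_cancel mult_cancel_right mult_is_0 neq0_conv)
  then show ?thesis
    using d by simp
qed

text \<open>Let \<open>h\<close> be the order of \<open>\<tau>\<close> on \<open>L\<close>. Counting
  homomorphisms gives \<open>h \<le> d\<close>; as \<open>L\<close> sits in the fixed field of
  \<open>\<tau> ^^ h\<close>, of degree \<open>h\<close>, also \<open>d \<le> h\<close>, and equal
  degrees force equality.\<close>

lemma intermediate_field_eq_fixed_field:
  assumes L: "subfield L R" and EL: "E \<subseteq> L" and dim: "dimension d E L"
  shows "L = fixed_field R (\<tau> ^^ d)"
proof -
  have LR: "L \<subseteq> carrier R"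
    using L by (rule subfieldE)
  define P where "P h \<longleftrightarrow> 0 < h \<and> (\<forall>x\<in>L. (\<tau> ^^ h) x = x)" for h
  have "P m"
    using m_pos period LR by (auto simp: P_def)
  define h where "h = (LEAST h. P h)"
  have h: "h > 0" "\<And>x. x \<in> L \<Longrightarrow> (\<tau> ^^ h) x = x" and h_le: "\<And>k. P k \<Longrightarrow> h \<le> k"
    using LeastI[of P, OF \<open>P m\<close>] Least_le[of P] by (auto simp: P_def h_def)
  have h_dvd: "h dvd m"
  proof (rule ccontr)
    assume "\<not> h dvd m"
    then have "0 < m mod h" "m mod h < h"
      using h(1) by (auto simp: dvd_eq_mod_eq_0)
    have "(\<tau> ^^ (m mod h)) x = x" if "x \<in> L" for x
    proof -
      have "((\<tau> ^^ h) ^^ t) x = x" for t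
        using h(2)[OF that] by (induction t) simp_all
      then have "(\<tau> ^^ (m mod h)) ((\<tau> ^^ (h * (m div h))) x) = (\<tau> ^^ (m mod h)) x"
        by (simp add: funpow_mult)
      then have "(\<tau> ^^ (m mod h)) x = (\<tau> ^^ m) x"
        by (metis comp_apply funpow_add mod_mult_div_eq)
      then show ?thesis
        using period[of x] that LR by auto
    qed
    then show False
      using h_le[of "m mod h"] \<open>0 < m mod h\<close> \<open>m mod h < h\<close> by (auto simp: P_def)
  qed
  \<comment> \<open>Powers with exponents below \<open>h\<close> differ on \<open>L\<close> itself,
    by minimality of \<open>h\<close>.\<close>
  have "card {..<h} \<le> d"
  proof (rule card_ring_homs_le_dimension[OF subfield_E L dim])
    show "\<tau> ^^ j \<in> ring_hom R R" for j by (rule funpow_hom)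
    show "(\<tau> ^^ j) x = x" if "x \<in> E" for j x using that by (rule funpow_fixed_E)
    have *: "\<exists>x\<in>L. (\<tau> ^^ i) x \<noteq> (\<tau> ^^ j) x" if ij: "i < j" "j < h" for i j
    proof -
      have "\<not> P (j - i)"
        using h_le[of "j - i"] ij by auto
      then obtain x where x: "x \<in> L" "(\<tau> ^^ (j - i)) x \<noteq> x"
        using ij by (auto simp: P_def)
      have "(\<tau> ^^ j) x = (\<tau> ^^ i) ((\<tau> ^^ (j - i)) x)"
        using ij by (simp flip: funpow_add[unfolded o_def, THEN fun_cong])
      then show ?thesis
        using x LR ring_hom_inj[OF funpow_hom[of i], of x "(\<tau> ^^ (j - i)) x"]
        by (metis funpow_hom_simps(1) subsetD)
    qed
    show "\<exists>x\<in>L. (\<tau> ^^ i) x \<noteq> (\<tau> ^^ j) x" if ij: "i \<in> {..<h}" "j \<in> {..<h}" "i \<noteq> j" for i j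
    proof (cases "i < j")
      case True
      then show ?thesis using * ij by simp
    next
      case False
      then obtain x where "x \<in> L" "(\<tau> ^^ j) x \<noteq> (\<tau> ^^ i) x"
        using *[of j i] ij by (metis lessThan_iff linorder_neqE_nat)
      then show ?thesis by (intro bexI[of _ x]) auto
    qed
  qed simp
  have sub: "L \<subseteq> fixed_field R (\<tau> ^^ h)"
    using h(2) LR by (auto simp: fixed_field_def)
  obtain us where us: "set us \<subseteq> carrier R" "independent E us" "length us = d" "Span E us = L"
    using exists_base[OF subfield_E dim] by blast
  have "set us \<subseteq> L"
    using Span_base_incl[OF subfield_E us(1)] us(4) by simp
  then have us_fixed: "set us \<subseteq> fixed_field R (\<tau> ^^ h)"
    using sub by blast
  note dim_h = dimension_fixed_funpow[OF h_dvd]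
  have "d \<le> h"
    using independent_length_le_dimension[OF subfield_E dim_h us(2) us_fixed] us(3) by simp
  then have "d = h"
    using \<open>card {..<h} \<le> d\<close> by simp
  then show ?thesis
    using independent_length_eq_dimension[OF subfield_E dim_h us(2) us_fixed] us by simp
qed

text \<open>Existence and uniqueness together justify the definite description in
  \<open>interm\<close>.\<close>

lemma interm_eq_fixed_field:
  assumes "p ^ i dvd m"
  shows "interm R E p i = fixed_field R (\<tau> ^^ (p ^ i))"
  unfolding interm_def
  using intermediate_field_eq_fixed_field subfield_fixed_funpow E_subset_fixed_field
    dimension_fixed_funpow[OF assms]
  by (intro the_equality) blast+

text \<open>Needed for the norm from \<open>K_(n-1)\<close> to the bottom, whose upper field is a
  fixed field taken as a record of its own.\<close>

lemma cyclic_automorphism_fixed_field: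
  assumes h: "h dvd m"
  shows "cyclic_automorphism (R\<lparr>carrier := fixed_field R (\<tau> ^^ h)\<rparr>) \<tau> h"
    and "fixed_field (R\<lparr>carrier := fixed_field R (\<tau> ^^ h)\<rparr>) \<tau> = E"
proof -
  let ?L = "fixed_field R (\<tau> ^^ h)"
  interpret L: field "R\<lparr>carrier := ?L\<rparr>"
    using subfield_iff(2)[OF subfield_fixed_funpow] .
  interpret h: cyclic_automorphism R "\<tau> ^^ h" "m div h"
    using h by (rule cyclic_automorphism_funpow)
  show "cyclic_automorphism (R\<lparr>carrier := ?L\<rparr>) \<tau> h"
  proof unfold_locales
    show "\<tau> \<in> ring_hom (R\<lparr>carrier := ?L\<rparr>) (R\<lparr>carrier := ?L\<rparr>)"
      using ring_hom_memE[OF hom] by (auto simp: ring_hom_def fixed_field_def funpow_swap1[symmetric])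
    show "0 < h"
      using h m_pos by (auto intro: Nat.gr0I)
    show "(\<tau> ^^ h) x = x" if "x \<in> carrier (R\<lparr>carrier := ?L\<rparr>)" for x
      using that by (simp add: fixed_field_def)
    show "\<exists>x\<in>carrier (R\<lparr>carrier := ?L\<rparr>). (\<tau> ^^ j) x \<noteq> x" if "0 < j" "j < h" for j
    proof (rule ccontr)
      assume "\<not> ?thesis"
      \<comment> \<open>A power \<open>\<tau> ^^ j\<close> trivial on the fixed field of
        \<open>\<tau> ^^ h\<close> is a power of \<open>\<tau> ^^ h\<close>; but
        \<open>0 < j < h\<close> is no multiple of \<open>h\<close>.\<close>
      then obtain k where k: "k < m div h" "\<forall>x\<in>carrier R. (\<tau> ^^ j) x = ((\<tau> ^^ h) ^^ k) x"
        using h.ring_hom_eq_funpow[OF funpow_hom, of j] by auto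
      have "j < m" "h * k < m" "j \<noteq> h * k"
        using k(1) that h m_pos dvd_imp_le[OF h] by (auto simp: less_mult_imp_div_less mult.commute)
      then show False
        using funpow_distinct[of j "h * k"] k(2) by (simp add: funpow_mult)
    qed
  qed
  show "fixed_field (R\<lparr>carrier := ?L\<rparr>) \<tau> = E"
    using E_subset_fixed_field[of h] by (auto simp: fixed_field_def)
qed

end

section \<open>From a cyclic extension to a generator\<close>

text \<open>\<open>Gal\<close> merely replaces the carrier of \<open>BijGroup\<close>, so this is
  what makes it a group.\<close>

lemma (in ring) subgroup_Gal:
  assumes "E \<subseteq> carrier R"
  shows "subgroup (carrier (Gal R E)) (BijGroup (carrier R))"
proof (intro group.subgroupI[OF group_BijGroup])
  show "carrier (Gal R E) \<subseteq> carrier (BijGroup (carrier R))"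
    by (auto simp: Gal_def BijGroup_def)
  have "restrict (\<lambda>x. x) (carrier R) \<in> carrier (Gal R E)"
    using assms by (auto simp: Gal_def id_Bij ring_hom_def)
  then show "carrier (Gal R E) \<noteq> {}"
    by blast
  fix g assume g: "g \<in> carrier (Gal R E)"
  then have bij: "g \<in> Bij (carrier R)" and fixed: "\<And>x. x \<in> E \<Longrightarrow> g x = x"
    by (auto simp: Gal_def)
  note g_hom = ring_hom_memE[of g R R]
  have hom: "g \<in> ring_hom R R"
    using g by (simp add: Gal_def)
  have inv_fixed: "inv_into (carrier R) g x = x" if "x \<in> carrier R" "g x = x" for x
    using bij that by (auto simp: Bij_def bij_betw_def intro: inv_into_f_eq)
  have "restrict (inv_into (carrier R) g) (carrier R) \<in> ring_hom R R"
    using Bij_inv_into_mem[OF bij] inv_fixed[of \<one>] g_hom[OF hom]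
      Bij_inv_into_lemma[where h = g and g = "(\<otimes>)", OF _ bij] Bij_inv_into_lemma[where h = g and g = "(\<oplus>)", OF _ bij]
    by (auto simp: ring_hom_def)
  then show "inv\<^bsub>BijGroup (carrier R)\<^esub> g \<in> carrier (Gal R E)"
    using bij fixed inv_fixed assms
    by (auto simp: Gal_def inv_BijGroup restrict_inv_into_Bij)
  fix h assume h: "h \<in> carrier (Gal R E)"
  have "compose (carrier R) g h \<in> ring_hom R R"
    using g h by (auto simp: Gal_def ring_hom_def compose_def Pi_iff)
  then show "g \<otimes>\<^bsub>BijGroup (carrier R)\<^esub> h \<in> carrier (Gal R E)"
    using g h assms compose_Bij[of g "carrier R" h]
    by (auto simp: Gal_def BijGroup_def compose_def subset_iff)
qed

text \<open>A generator has the same fixed elements as the whole group, namely \<open>F\<close>. The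
  finite degree forces its order to be finite, and Artin's theorem identifies the order with the
  degree.\<close>

lemma cyclic_extension_automorphism:
  assumes "cyclic_extension K F d"
  obtains \<sigma> where "cyclic_automorphism K \<sigma> d" and "fixed_field K \<sigma> = F"
proof -
  have ext: "galois_extension K F" "cyclic_group (Gal K F)" "ring.dimension K d F (carrier K)"
    using assms by (auto simp: cyclic_extension_def)
  interpret field K
    using ext by (simp add: galois_extension_def)
  have F: "subfield F K" and fix_F: "{x \<in> carrier K. \<forall>g\<in>carrier (Gal K F). g x = x} = F"
    using ext by (auto simp: galois_extension_def)
  have FK: "F \<subseteq> carrier K"
    using F by (rule subfieldE)
  note sub = subgroup_Gal[OF FK]
  have Gal_eq: "Gal K F = BijGroup (carrier K)\<lparr>carrier := carrier (Gal K F)\<rparr>"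
    by (simp add: Gal_def)
  interpret G: group "Gal K F"
    using subgroup.subgroup_is_group[OF sub group_BijGroup] by (simp flip: Gal_eq)
  obtain \<sigma> where \<sigma>: "\<sigma> \<in> carrier (Gal K F)" and "subgroup_generated (Gal K F) {\<sigma>} = Gal K F"
    using ext(2) by (auto simp: cyclic_group_def)
  then have gen: "carrier (Gal K F) = generate (Gal K F) {\<sigma>}"
    using \<sigma> carrier_subgroup_generated[of "Gal K F" "{\<sigma>}"] by (simp add: Int_absorb1)
  have hom: "\<sigma> \<in> ring_hom K K" and bij: "\<sigma> \<in> Bij (carrier K)" and fixed: "\<And>x. x \<in> F \<Longrightarrow> \<sigma> x = x"
    using \<sigma> by (auto simp: Gal_def)
  have Gal_mult: "(g \<otimes>\<^bsub>Gal K F\<^esub> h) x = g (h x)"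
    if "g \<in> carrier (Gal K F)" "h \<in> carrier (Gal K F)" "x \<in> carrier K" for g h x
    using that by (simp add: Gal_def BijGroup_def compose_def)
  have Gal_one: "\<one>\<^bsub>Gal K F\<^esub> x = x" if "x \<in> carrier K" for x
    using that by (simp add: Gal_def BijGroup_def)
  have fix_\<sigma>: "fixed_field K \<sigma> = F"
  proof
    show "F \<subseteq> fixed_field K \<sigma>"
      using FK fixed by (auto simp: fixed_field_def)
    show "fixed_field K \<sigma> \<subseteq> F"
    proof
      fix x assume x: "x \<in> fixed_field K \<sigma>"
      then have xK: "x \<in> carrier K" and \<sigma>x: "\<sigma> x = x"
        by (auto simp: fixed_field_def)
      have "g \<in> carrier (Gal K F) \<and> g x = x" if "g \<in> generate (Gal K F) {\<sigma>}" for g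
        using that
      proof induction
        case one
        then show ?case using Gal_one[OF xK] by simp
      next
        case (incl h)
        then show ?case using \<sigma> \<sigma>x by simp
      next
        case (inv h)
        then have "h = \<sigma>" by simp
        then show ?case
          using \<sigma> \<sigma>x Gal_mult[of "inv\<^bsub>Gal K F\<^esub> \<sigma>" \<sigma> x] Gal_one[OF xK] xK by simp
      next
        case (eng g h)
        then show ?case using Gal_mult xK by simp
      qed
      then show "x \<in> F"
        using xK gen fix_F by blast
    qed
  qed
  define P where "P j \<longleftrightarrow> 0 < j \<and> (\<forall>x\<in>carrier K. (\<sigma> ^^ j) x = x)" for j
  note funpow_hom = funpow_ring_hom[OF hom]
  have "\<exists>j. P j"
  proof (rule ccontr)
    assume "\<nexists>j. P j"
    \<comment> \<open>With no positive period, \<open>d + 1\<close> powers would already be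
      distinct, too many for degree \<open>d\<close>.\<close>
    have "card {..d} \<le> d"
    proof (rule card_ring_homs_le_dimension[OF F carrier_is_subfield ext(3)])
      show "\<sigma> ^^ j \<in> ring_hom K K" for j by (rule funpow_hom)
      show "(\<sigma> ^^ j) x = x" if "x \<in> F" for j x
        using fixed[OF that] by (induction j) simp_all
      have *: "\<exists>x\<in>carrier K. (\<sigma> ^^ i) x \<noteq> (\<sigma> ^^ j) x" if "i < j" for i j
      proof -
        obtain x where x: "x \<in> carrier K" "(\<sigma> ^^ (j - i)) x \<noteq> x"
          using \<open>\<nexists>j. P j\<close> \<open>i < j\<close> unfolding P_def by (meson zero_less_diff)
        have "(\<sigma> ^^ j) x = (\<sigma> ^^ i) ((\<sigma> ^^ (j - i)) x)"
          using that by (simp flip: funpow_add[unfolded o_def, THEN fun_cong])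
        then show ?thesis
          using x ring_hom_inj[OF funpow_hom[of i], of x "(\<sigma> ^^ (j - i)) x"]
            ring_hom_closed[OF funpow_hom] by metis
      qed
      show "\<exists>x\<in>carrier K. (\<sigma> ^^ i) x \<noteq> (\<sigma> ^^ j) x" if ij: "i \<noteq> j" for i j
      proof (cases "i < j")
        case False
        then obtain x where "x \<in> carrier K" "(\<sigma> ^^ j) x \<noteq> (\<sigma> ^^ i) x"
          using *[of j i] ij by (metis linorder_neqE_nat)
        then show ?thesis by (intro bexI[of _ x]) auto
      qed (rule *)
    qed simp
    then show False by simp
  qed
  then obtain k where "P k" by blast
  define m where "m = (LEAST j. P j)"
  have Pm: "P m" and minimal: "\<And>j. P j \<Longrightarrow> m \<le> j"
    unfolding m_def using LeastI[of P, OF \<open>P k\<close>] Least_le[of P] by auto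
  interpret \<sigma>: cyclic_automorphism K \<sigma> m
  proof unfold_locales
    show "\<exists>x\<in>carrier K. (\<sigma> ^^ j) x \<noteq> x" if "0 < j" "j < m" for j
      using minimal[of j] that by (auto simp: P_def)
  qed (use hom Pm in \<open>auto simp: P_def\<close>)
  have "m = d"
    using dimension_is_inj[OF F] \<sigma>.dimension_E ext(3) fix_\<sigma> by simp
  then show thesis
    using that \<sigma>.cyclic_automorphism_axioms fix_\<sigma> by blast
qed

section \<open>Classes of pth powers\<close>

context field
begin

lemma comm_group_units: "comm_group (units_group R)"
  by (rule group.group_comm_groupI[OF field_mult_group]) (auto simp: m_comm)

lemma normal_pth_powers: "pth_powers R p \<lhd> units_group R"
proof -
  interpret U: comm_group "units_group R"
    by (rule comm_group_units)
  note pow = Multiplicative_Group.nat_pow_mult_of[of R, symmetric]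
  have "subgroup (pth_powers R p) (units_group R)"
  proof (rule U.subgroupI)
    show "pth_powers R p \<subseteq> carrier (units_group R)"
      unfolding pth_powers_def nonzero_def pow using U.nat_pow_closed by auto
    show "pth_powers R p \<noteq> {}"
      unfolding pth_powers_def nonzero_def using U.one_closed by blast
    have pow_mem: "k [^]\<^bsub>units_group R\<^esub> p \<in> pth_powers R p" if "k \<in> carrier (units_group R)" for k
      using that unfolding pth_powers_def nonzero_def pow by (rule imageI)
    have powE: "\<exists>k\<in>carrier (units_group R). a = k [^]\<^bsub>units_group R\<^esub> p" if "a \<in> pth_powers R p" for a
      using that unfolding pth_powers_def nonzero_def pow by blast
    show "inv\<^bsub>units_group R\<^esub> a \<in> pth_powers R p" if "a \<in> pth_powers R p" for a
      using powE[OF that] pow_mem U.nat_pow_inv U.inv_closed by metis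
    show "a \<otimes>\<^bsub>units_group R\<^esub> b \<in> pth_powers R p"
      if "a \<in> pth_powers R p" "b \<in> pth_powers R p" for a b
    proof -
      obtain k l where "k \<in> carrier (units_group R)" "l \<in> carrier (units_group R)"
        and ab: "a = k [^]\<^bsub>units_group R\<^esub> p" "b = l [^]\<^bsub>units_group R\<^esub> p"
        using powE[OF \<open>a \<in> pth_powers R p\<close>] powE[OF \<open>b \<in> pth_powers R p\<close>] by blast
      then show ?thesis
        unfolding ab using pow_mem[OF U.m_closed] U.pow_mult_distrib[OF U.m_comm, of k l p] by metis
    qed
  qed
  then show ?thesis
    by (rule U.subgroup_imp_normal)
qed

lemma mem_pth_class: "z \<in> pth_class R p x \<longleftrightarrow> (\<exists>k\<in>nonzero R. z = k [^] p \<otimes> x)"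
  by (auto simp: pth_class_def pth_powers_def r_coset_def)

lemma pth_class_eq_iff:
  assumes "x \<in> nonzero R" "y \<in> nonzero R"
  shows "pth_class R p x = pth_class R p y \<longleftrightarrow> (\<exists>k\<in>nonzero R. x = y \<otimes> k [^] p)"
proof -
  interpret normal "pth_powers R p" "units_group R"
    by (rule normal_pth_powers)
  have x: "x \<in> carrier (units_group R)" and y: "y \<in> carrier (units_group R)"
    using assms by (auto simp: nonzero_def)
  have "pth_class R p x = pth_class R p y \<longleftrightarrow> x \<in> pth_class R p y"
    unfolding pth_class_def using x y
    by (metis repr_independence rcos_self subgroup_axioms)
  also have "\<dots> \<longleftrightarrow> (\<exists>k\<in>nonzero R. x = y \<otimes> k [^] p)"
    unfolding mem_pth_class using y by (intro bex_cong) (auto simp: m_comm nonzero_def)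
  finally show ?thesis .
qed

lemma pth_class_in_carrier: "x \<in> nonzero R \<Longrightarrow> pth_class R p x \<in> carrier (pth_classes R p)"
  by (auto simp: pth_classes_def carrier_FactGroup pth_class_def nonzero_def)

lemma pth_class_quotient:
  assumes "x \<in> nonzero R" "y \<in> nonzero R"
  shows "pth_class R p x \<otimes>\<^bsub>pth_classes R p\<^esub> inv\<^bsub>pth_classes R p\<^esub> pth_class R p y =
    pth_class R p (x \<otimes> inv\<^bsub>units_group R\<^esub> y)"
proof -
  interpret normal "pth_powers R p" "units_group R"
    by (rule normal_pth_powers)
  have "x \<in> carrier (units_group R)" "y \<in> carrier (units_group R)"
    using assms by (auto simp: nonzero_def)
  then show ?thesis
    using inv_FactGroup[of "pth_class R p y"] pth_class_in_carrier[OF assms(2), of p]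
    by (simp add: pth_classes_def pth_class_def rcos_inv rcos_sum del: Multiplicative_Group.carrier_mult_of)
qed

lemma pth_class_subfield_neq_one_iff:
  assumes "subfield L R" "x \<in> L" "x \<noteq> \<zero>"
  shows "pth_class (R\<lparr>carrier := L\<rparr>) p x \<noteq> pth_class (R\<lparr>carrier := L\<rparr>) p \<one> \<longleftrightarrow>
    \<not> (\<exists>f\<in>L - {\<zero>}. x = f [^] p)"
proof -
  interpret L: field "R\<lparr>carrier := L\<rparr>"
    using subfield_iff(2)[OF assms(1)] .
  have LR: "L \<subseteq> carrier R"
    using assms(1) by (rule subfieldE)
  have "pth_class (R\<lparr>carrier := L\<rparr>) p x = pth_class (R\<lparr>carrier := L\<rparr>) p \<one> \<longleftrightarrow>
    (\<exists>f\<in>L - {\<zero>}. x = \<one> \<otimes> f [^] p)"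
    using L.pth_class_eq_iff[of x \<one> p] assms L.one_closed L.one_not_zero
    by (simp add: nonzero_def flip: nat_pow_consistent)
  also have "\<dots> \<longleftrightarrow> (\<exists>f\<in>L - {\<zero>}. x = f [^] p)"
    using LR by (intro bex_cong) auto
  finally show ?thesis by simp
qed

end

section \<open>The Galois action on classes\<close>

context cyclic_automorphism
begin

lemma Gal_nonzero:
  assumes "g \<in> carrier (Gal R E)" "x \<in> nonzero R" shows "g x \<in> nonzero R"
  using assms nonzero_funpow by (auto simp: carrier_Gal nonzero_def)

text \<open>An automorphism permutes the units and so maps the \<open>p\<close>-th powers onto
  themselves; hence the image of a coset is again a full coset.\<close>

lemma image_pth_class:
  assumes g: "g \<in> carrier (Gal R E)" and x: "x \<in> nonzero R"
  shows "g ` pth_class R p x = pth_class R p (g x)"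
proof -
  have hom: "g \<in> ring_hom R R" and bij: "g ` carrier R = carrier R"
    using g by (auto simp: Gal_def Bij_def bij_betw_def)
  interpret g: ring_hom_ring R R g
    using hom by unfold_locales
  have g_class: "g (k [^] p \<otimes> x) = g k [^] p \<otimes> g x" if "k \<in> nonzero R" for k
    using that x by (simp add: nonzero_def g.hom_nat_pow)
  have surj: "\<exists>l\<in>nonzero R. k = g l" if k: "k \<in> nonzero R" for k
  proof -
    obtain l where "l \<in> carrier R" "k = g l"
      using k bij by (auto simp: nonzero_def)
    then show ?thesis
      using k by (auto simp: nonzero_def intro!: bexI[of _ l])
  qed
  show ?thesis
  proof
    show "g ` pth_class R p x \<subseteq> pth_class R p (g x)"
      using g_class Gal_nonzero[OF g] by (fastforce simp: mem_pth_class)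
    show "pth_class R p (g x) \<subseteq> g ` pth_class R p x"
    proof
      fix z assume "z \<in> pth_class R p (g x)"
      then obtain l where "l \<in> nonzero R" "z = g l [^] p \<otimes> g x"
        using surj by (auto simp: mem_pth_class)
      then show "z \<in> g ` pth_class R p x"
        using g_class[of l] by (intro image_eqI[of _ g "l [^] p \<otimes> x"]) (auto simp: mem_pth_class)
    qed
  qed
qed

lemma pth_class_tau_minus_one_mem_iff:
  assumes \<delta>: "\<delta> \<in> nonzero R" and g: "g \<in> carrier (Gal R E)" and U: "U \<subseteq> nonzero R"
  shows "class_tau_minus_one R p g (pth_class R p \<delta>) \<in> pth_class R p ` U \<longleftrightarrow>
    (\<exists>y\<in>U. \<exists>k\<in>nonzero R. g \<delta> = \<delta> \<otimes> y \<otimes> k [^] p)"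
proof -
  let ?v = "g \<delta> \<otimes> inv\<^bsub>units_group R\<^esub> \<delta>"
  have \<delta>': "\<delta> \<in> carrier (units_group R)" and g\<delta>: "g \<delta> \<in> carrier (units_group R)"
    using \<delta> Gal_nonzero[OF g \<delta>] by (auto simp: nonzero_def)
  have v: "?v \<in> nonzero R"
    using units.m_closed[OF g\<delta> units.inv_closed[OF \<delta>']] by (simp add: nonzero_def)
  have v_iff: "?v = y \<longleftrightarrow> g \<delta> = \<delta> \<otimes> y" if "y \<in> nonzero R" for y
    using units.quotient_cancel[OF \<delta>' g\<delta>] units.l_cancel[of \<delta> ?v y] that \<delta>' v
    unfolding nonzero_def Multiplicative_Group.mult_mult_of by metis
  have closed: "y \<otimes> k [^] p \<in> nonzero R" if "y \<in> U" "k \<in> nonzero R" for y k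
    using units.m_closed[of y "k [^] p"] units.nat_pow_closed[of k p] that U
    by (auto simp: nonzero_def Multiplicative_Group.nat_pow_mult_of)
  have "class_tau_minus_one R p g (pth_class R p \<delta>) = pth_class R p ?v"
    unfolding class_tau_minus_one_def image_pth_class[OF g \<delta>]
    using Gal_nonzero[OF g \<delta>] \<delta> by (rule pth_class_quotient)
  moreover have "pth_class R p ?v \<in> pth_class R p ` U \<longleftrightarrow>
      (\<exists>y\<in>U. \<exists>k\<in>nonzero R. ?v = y \<otimes> k [^] p)"
    unfolding image_iff using U by (intro bex_cong refl pth_class_eq_iff v) auto
  moreover have "\<dots> \<longleftrightarrow> (\<exists>y\<in>U. \<exists>k\<in>nonzero R. g \<delta> = \<delta> \<otimes> y \<otimes> k [^] p)"
  proof (intro bex_cong refl)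
    fix y k assume yk: "y \<in> U" "k \<in> nonzero R"
    then have "y \<in> carrier R" "k \<in> carrier R" "\<delta> \<in> carrier R"
      using U \<delta> by (auto simp: nonzero_def)
    then show "?v = y \<otimes> k [^] p \<longleftrightarrow> g \<delta> = \<delta> \<otimes> y \<otimes> k [^] p"
      using v_iff[OF closed[OF yk]] by (simp add: m_assoc)
  qed
  ultimately show ?thesis by simp
qed

lemma generator_in_Gal: "restrict \<tau> (carrier R) \<in> carrier (Gal R E)"
  using funpow_in_Gal[of 1] by simp

text \<open>The generator decides for the whole group: from
  \<open>\<tau> \<delta> = \<delta> \<otimes> y \<otimes> k [^] p\<close> the quotient for
  \<open>\<tau> ^^ j\<close> is the partial norm of \<open>y\<close> times a \<open>p\<close>-th
  power. Hence \<open>U\<close> must be closed under partial norms.\<close>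

lemma all_tau_minus_one_mem_iff:
  assumes \<delta>: "\<delta> \<in> nonzero R" and U: "U \<subseteq> nonzero R"
    and orbit: "\<And>y j. y \<in> U \<Longrightarrow> orbit_prod R \<tau> j y \<in> U"
  shows "(\<forall>g\<in>carrier (Gal R E). class_tau_minus_one R p g (pth_class R p \<delta>) \<in> pth_class R p ` U)
    \<longleftrightarrow> (\<exists>y\<in>U. \<exists>k\<in>nonzero R. \<tau> \<delta> = \<delta> \<otimes> y \<otimes> k [^] p)" (is "?L \<longleftrightarrow> ?R")
proof
  have \<delta>R: "\<delta> \<in> carrier R"
    using \<delta> by (simp add: nonzero_def)
  show ?R if ?L
    using that generator_in_Gal pth_class_tau_minus_one_mem_iff[OF \<delta> generator_in_Gal U, of p] \<delta>R
    by simp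
  assume ?R
  then obtain y k where y: "y \<in> U" and k: "k \<in> nonzero R" and eq: "\<tau> \<delta> = \<delta> \<otimes> y \<otimes> k [^] p"
    by blast
  note pow = Multiplicative_Group.nat_pow_mult_of[of R, symmetric]
  have yk: "\<delta> \<in> carrier (units_group R)" "y \<in> carrier (units_group R)" "k \<in> carrier (units_group R)"
    using y k U \<delta> by (auto simp: nonzero_def)
  show ?L
  proof
    fix g assume g: "g \<in> carrier (Gal R E)"
    then obtain j where j: "g = restrict (\<tau> ^^ j) (carrier R)"
      by (auto simp: carrier_Gal)
    have "(\<tau> ^^ j) \<delta> = \<delta> \<otimes> units.N j (y \<otimes> k [^]\<^bsub>units_group R\<^esub> p)"
      using units.funpow_of_quotient[of \<delta> "y \<otimes> k [^]\<^bsub>units_group R\<^esub> p" j] yk eq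
        units.m_closed[of y "k [^]\<^bsub>units_group R\<^esub> p"] units.m_assoc[of \<delta> y "k [^]\<^bsub>units_group R\<^esub> p"]
        units.nat_pow_closed[of k p]
      by (simp add: pow)
    also have "units.N j (y \<otimes> k [^]\<^bsub>units_group R\<^esub> p) = units.N j y \<otimes> units.N j k [^] p"
      using units.N_mult[of y "k [^]\<^bsub>units_group R\<^esub> p" j] yk units.N_pow[of k j p]
        units.nat_pow_closed[of k p]
      by (simp add: pow)
    finally have "g \<delta> = \<delta> \<otimes> orbit_prod R \<tau> j y \<otimes> orbit_prod R \<tau> j k [^] p"
      using \<delta>R units.N_closed[of y j] units.N_closed[of k j] yk
      by (simp add: j m_assoc)
    moreover have "orbit_prod R \<tau> j k \<in> nonzero R"
      using units.N_closed[of k j] yk by (simp add: nonzero_def)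
    ultimately show "class_tau_minus_one R p g (pth_class R p \<delta>) \<in> pth_class R p ` U"
      using pth_class_tau_minus_one_mem_iff[OF \<delta> g U] orbit[OF y] by blast
  qed
qed

text \<open>Invariance of a class is the case \<open>U = {\<one>}\<close> of the preceding
  criterion.\<close>

lemma pth_class_fixed_iff:
  assumes \<delta>: "\<delta> \<in> nonzero R"
  shows "pth_class R p \<delta> \<in> fixed_classes R p (Gal R E) \<longleftrightarrow>
    (\<exists>k\<in>nonzero R. \<tau> \<delta> = \<delta> \<otimes> k [^] p)"
proof -
  have one: "{\<one>} \<subseteq> nonzero R" and \<delta>R: "\<delta> \<in> carrier R"
    using \<delta> by (auto simp: nonzero_def)
  have "g ` pth_class R p \<delta> = pth_class R p \<delta> \<longleftrightarrow>
      class_tau_minus_one R p g (pth_class R p \<delta>) \<in> pth_class R p ` {\<one>}"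
    if g: "g \<in> carrier (Gal R E)" for g
    unfolding pth_class_tau_minus_one_mem_iff[OF \<delta> g one] image_pth_class[OF g \<delta>]
    using pth_class_eq_iff[OF Gal_nonzero[OF g \<delta>] \<delta>] \<delta>R by simp
  moreover have "orbit_prod R \<tau> j \<one> = \<one>" for j
    using units.N_one[of j] by simp
  ultimately show ?thesis
    using all_tau_minus_one_mem_iff[OF \<delta> one, of p] \<delta>R pth_class_in_carrier[OF \<delta>]
    by (simp add: fixed_classes_def)
qed

lemma cyclic_p_module_units:
  assumes p: "Factorial_Ring.prime p" and n: "n \<ge> 1" and m: "m = p ^ n"
    and \<xi>: "\<xi> \<in> E" and ord: "group.ord (units_group R) \<xi> = p"
  shows "cyclic_p_module (units_group R) \<tau> p n \<xi>"
proof -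
  have p_pos: "p > 0" "p \<noteq> 1"
    using prime_gt_1_nat[OF p] by auto
  note pow = Multiplicative_Group.nat_pow_mult_of[of R]
  have \<xi>R: "\<xi> \<in> carrier R" "\<tau> \<xi> = \<xi>"
    using \<xi> by (auto simp: fixed_field_def)
  \<comment> \<open>Membership in \<open>E\<close> does not exclude zero. Only the zeroth power of
    zero is one, so its \<open>ord\<close> would be 0 and not \<open>p\<close>.\<close>
  have "\<xi> \<noteq> \<zero>"
  proof
    assume "\<xi> = \<zero>"
    then have "(\<xi> [^]\<^bsub>units_group R\<^esub> k = \<one>\<^bsub>units_group R\<^esub>) = (k = 0)" for k :: nat
      by (cases k) (simp_all add: pow)
    then have "group.ord (units_group R) \<xi> = 0"
      unfolding units.ord_def by (intro some_equality) (metis dvd_0_left_iff dvd_refl)+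
    then show False
      using ord p_pos by simp
  qed
  then have \<xi>U: "\<xi> \<in> carrier (units_group R)"
    using \<xi>R by simp
  have \<xi>_pow: "\<xi> [^] p = \<one>"
    using units.pow_ord_eq_1[OF \<xi>U] by (simp add: ord pow)
  have \<xi>_inj: "i = j" if "i < p" "j < p" "\<xi> [^] i = \<xi> [^] j" for i j
  proof -
    have "i \<in> {0..p - 1}" "j \<in> {0..p - 1}"
      using that by auto
    then show ?thesis
      using inj_onD[OF units.ord_inj[OF \<xi>U], of i j] that(3) by (simp add: ord pow)
  qed
  show ?thesis
  proof unfold_locales
    show "Factorial_Ring.prime p" "1 \<le> n" by fact+
    show "(\<tau> ^^ p ^ n) x = x" if "x \<in> carrier (units_group R)" for x
      using that period m by simp
    show "\<xi> \<in> carrier (units_group R)" "\<tau> \<xi> = \<xi>" by fact+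
    show "\<xi> [^]\<^bsub>units_group R\<^esub> p = \<one>\<^bsub>units_group R\<^esub>"
      using \<xi>_pow by (simp add: pow)
    show "\<xi> \<noteq> \<one>\<^bsub>units_group R\<^esub>"
      using units.ord_id ord p_pos by auto
    show "\<exists>j::nat. z = \<xi> [^]\<^bsub>units_group R\<^esub> j"
      if "z \<in> carrier (units_group R)" "z [^]\<^bsub>units_group R\<^esub> p = \<one>\<^bsub>units_group R\<^esub>" for z
    proof -
      have "\<exists>j::nat. z = \<xi> [^] j"
        by (rule root_of_unity_is_power[OF \<xi>R(1) \<xi>_pow _ _ \<xi>_inj p_pos(1)])
          (use that in \<open>simp_all add: pow\<close>)
      then show ?thesis
        by (simp add: pow)
    qed
    show "\<exists>\<theta>\<in>carrier (units_group R). (\<tau> ^^ p ^ i) \<theta> = \<theta> \<otimes>\<^bsub>units_group R\<^esub> u"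
      if "i \<le> n" "u \<in> carrier (units_group R)"
        "orbit_prod (units_group R) (\<tau> ^^ p ^ i) (p ^ (n - i)) u = \<one>\<^bsub>units_group R\<^esub>" for i u
    proof -
      interpret i: cyclic_automorphism R "\<tau> ^^ (p ^ i)" "m div p ^ i"
        using that m by (intro cyclic_automorphism_funpow) (simp add: le_imp_power_dvd)
      have "m div p ^ i = p ^ (n - i)"
        using that m p_pos by (simp add: power_diff)
      then show ?thesis
        using i.hilbert90[OF that(2)] that(3) by simp
    qed
  qed
qed

end

section \<open>The invariant of a cyclic extension\<close>

text \<open>Each set is rewritten through a generator \<open>\<sigma>\<close> into a condition on
  the unit group, and \<open>Min_indices\<close> then compares the minima.\<close>

theorem theorem3:
  fixes K (structure) and F :: "'a set" and p n :: nat and \<xi> :: 'a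
  assumes "Factorial_Ring.prime p" and "n \<ge> 1"
    and "cyclic_extension K F (p ^ n)"
    and "\<xi> \<in> F" and "group.ord (Multiplicative_Group.mult_of K) \<xi> = p"
    and "p = 2 \<Longrightarrow> n > 1 \<or> \<ominus> \<one> \<in> field_norm K F ` nonzero K"
  shows "let
      A = {s \<in> indices_below n. \<xi> \<in> (field_norm K F ` nonzero K) <#>
             (field_norm (interm_field K F p (n - 1)) F ` interm_units K F p s)};
      B = {s \<in> indices_below n.
             \<xi> \<in> field_norm K (interm K F p (dot_succ s)) ` nonzero K};
      C = {s \<in> indices_below n. \<exists>\<delta>\<in>nonzero K.
             pth_class K p \<delta> \<in> fixed_classes K p (Gal K (interm K F p (dot_succ s))) \<and>
             pth_class (interm_field K F p (dot_succ s)) p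
               (field_norm K (interm K F p (dot_succ s)) \<delta>) \<noteq>
             pth_class (interm_field K F p (dot_succ s)) p \<one>}
    in i_candidates K F p n \<noteq> {} \<and> A \<noteq> {} \<and> B \<noteq> {} \<and> C \<noteq> {} \<and>
       i_inv K F p n = Min A \<and> Min A = Min B \<and> Min B = Min C"
proof -
  obtain \<sigma> where aut: "cyclic_automorphism K \<sigma> (p ^ n)" and F: "fixed_field K \<sigma> = F"
    using cyclic_extension_automorphism[OF assms(3)] .
  interpret cyclic_automorphism K \<sigma> "p ^ n" by (rule aut)
  interpret P: cyclic_p_module "units_group K" \<sigma> p n \<xi>
    using assms F by (intro cyclic_p_module_units) auto
  note pow = Multiplicative_Group.nat_pow_mult_of[of K]
  have p_pos: "p > 0"
    using assms(1) by (rule prime_gt_0_nat)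
  have interm: "interm K F p i = fixed_field K (\<sigma> ^^ (p ^ i))" if "i \<le> n" for i
    using interm_eq_fixed_field[of p i] that F by (simp add: le_imp_power_dvd)
  have level: "cyclic_automorphism K (\<sigma> ^^ (p ^ i)) (p ^ (n - i))" if "i \<le> n" for i
    using cyclic_automorphism_funpow[of "p ^ i"] that p_pos by (simp add: le_imp_power_dvd power_diff)
  \<comment> \<open>The range reaches \<open>n\<close> because the candidates for
    \<open>i(K/F)\<close> include that index.\<close>
  have fixed_units: "interm_units K F p s = P.fixed_units s" if "s \<in> indices_below (n + 1)" for s
    using that interm by (cases s) (auto simp: indices_below_def nonzero_def fixed_field_def)
  have norm_K: "field_norm K F x = orbit_prod K \<sigma> (p ^ n) x" if "x \<in> nonzero K" for x
    using field_norm_eq_orbit_prod[of x] that F by (simp add: nonzero_def)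
  have norm_level: "field_norm K (interm K F p i) x = orbit_prod K (\<sigma> ^^ (p ^ i)) (p ^ (n - i)) x"
    if "i \<le> n" "x \<in> nonzero K" for i x
    using cyclic_automorphism.field_norm_eq_orbit_prod[OF level[OF that(1)], of x] that interm
    by (simp add: nonzero_def)
  \<comment> \<open>Every \<open>K_s\<close> with \<open>s\<close> below \<open>n\<close> lies in
    \<open>K_(n-1)\<close>, on which \<open>\<sigma>\<close> has order
    \<open>p ^ (n - 1)\<close>.\<close>
  have norm_top: "field_norm (interm_field K F p (n - 1)) F x = orbit_prod K \<sigma> (p ^ (n - 1)) x"
    if "s \<in> indices_below n" "x \<in> P.fixed_units s" for s x
  proof -
    have dvd: "p ^ (n - 1) dvd p ^ n"
      by (simp add: le_imp_power_dvd)
    have "x \<in> fixed_field K (\<sigma> ^^ (p ^ (n - 1)))"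
    proof (cases s)
      case (Some i)
      then have "(\<sigma> ^^ (p ^ (n - 1))) x = x"
        using that P.fixed_level_mono[of i x "n - 1"] by (auto simp: indices_below_def)
      then show ?thesis
        using that Some by (auto simp: fixed_field_def)
    qed (use that in \<open>auto simp: fixed_field_def\<close>)
    then show ?thesis
      using cyclic_automorphism.field_norm_eq_orbit_prod[OF cyclic_automorphism_fixed_field(1)[OF dvd], of x]
      unfolding cyclic_automorphism_fixed_field(2)[OF dvd] F by (simp add: interm)
  qed
  have carrier: "nonzero K = carrier (units_group K)"
    by (simp add: nonzero_def)
  have holds_A: "\<xi> \<in> (field_norm K F ` nonzero K) <#>
      (field_norm (interm_field K F p (n - 1)) F ` interm_units K F p s) \<longleftrightarrow> P.holds_A s"
    if s: "s \<in> indices_below n" for s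
  proof -
    have s': "s \<in> indices_below (n + 1)"
      using s by (auto simp: indices_below_def)
    show ?thesis
      unfolding P.holds_A_def set_mult_def fixed_units[OF s'] carrier[symmetric]
      using norm_K norm_top[OF s] by auto
  qed
  have dot_succ_le: "dot_succ s \<le> n" if "s \<in> indices_below n" for s
    using that by (cases s) (auto simp: indices_below_def)
  have holds_B: "\<xi> \<in> field_norm K (interm K F p (dot_succ s)) ` nonzero K \<longleftrightarrow> P.holds_B s"
    if s: "s \<in> indices_below n" for s
    unfolding P.holds_B_def carrier[symmetric]
    using norm_level[OF dot_succ_le[OF s]] by auto
  have norm_class: "pth_class (interm_field K F p i) p (orbit_prod K (\<sigma> ^^ (p ^ i)) (p ^ (n - i)) \<delta>) \<noteq>
      pth_class (interm_field K F p i) p \<one> \<longleftrightarrow>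
      \<not> (\<exists>f\<in>carrier (units_group K). (\<sigma> ^^ (p ^ i)) f = f \<and>
        P.norm_down i \<delta> = f [^]\<^bsub>units_group K\<^esub> p)"
    if i: "i \<le> n" and \<delta>: "\<delta> \<in> nonzero K" for i \<delta>
  proof -
    let ?x = "orbit_prod K (\<sigma> ^^ (p ^ i)) (p ^ (n - i)) \<delta>"
    interpret i: cyclic_automorphism K "\<sigma> ^^ (p ^ i)" "p ^ (n - i)"
      by (rule level[OF i])
    have "?x \<in> i.E" "?x \<noteq> \<zero>"
      using i.units.N_closed[of \<delta> "p ^ (n - i)"] i.units.endo_N_fixed[of \<delta> "p ^ (n - i)"] \<delta>
        P.level_period[OF i, of \<delta>]
      by (auto simp: nonzero_def fixed_field_def)
    then show ?thesis
      unfolding interm[OF i] using pth_class_subfield_neq_one_iff[OF i.subfield_E, of ?x p]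
      by (auto simp: pow fixed_field_def)
  qed
  have holds_C: "(\<exists>\<delta>\<in>nonzero K.
             pth_class K p \<delta> \<in> fixed_classes K p (Gal K (interm K F p (dot_succ s))) \<and>
             pth_class (interm_field K F p (dot_succ s)) p
               (field_norm K (interm K F p (dot_succ s)) \<delta>) \<noteq>
             pth_class (interm_field K F p (dot_succ s)) p \<one>) \<longleftrightarrow> P.holds_C s"
    if s: "s \<in> indices_below n" for s
    unfolding P.holds_C_def carrier[symmetric]
  proof (intro bex_cong refl conj_cong)
    fix \<delta> assume \<delta>: "\<delta> \<in> nonzero K"
    note i = dot_succ_le[OF s]
    show "pth_class K p \<delta> \<in> fixed_classes K p (Gal K (interm K F p (dot_succ s))) \<longleftrightarrow>
      (\<exists>k\<in>nonzero K. (\<sigma> ^^ p ^ dot_succ s) \<delta> =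
        \<delta> \<otimes>\<^bsub>units_group K\<^esub> k [^]\<^bsub>units_group K\<^esub> p)"
      using cyclic_automorphism.pth_class_fixed_iff[OF level[OF i] \<delta>, of p]
      by (simp add: interm[OF i] pow)
    show "(pth_class (interm_field K F p (dot_succ s)) p
               (field_norm K (interm K F p (dot_succ s)) \<delta>) \<noteq>
             pth_class (interm_field K F p (dot_succ s)) p \<one>) \<longleftrightarrow>
      \<not> (\<exists>f\<in>nonzero K. (\<sigma> ^^ p ^ dot_succ s) f = f \<and>
        P.norm_down (dot_succ s) \<delta> = f [^]\<^bsub>units_group K\<^esub> p)"
      unfolding norm_level[OF i \<delta>] carrier by (rule norm_class[OF i \<delta>])
  qed
  have candidates: "i_candidates K F p n = {s \<in> indices_below (n + 1). P.holds_I s}"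
    unfolding i_candidates_def
  proof (intro Collect_cong conj_cong refl)
    fix s assume s: "s \<in> indices_below (n + 1)"
    show "(\<exists>\<delta>\<in>nonzero K.
       pth_class (K\<lparr>carrier := F\<rparr>) p (field_norm K F \<delta>) \<noteq> pth_class (K\<lparr>carrier := F\<rparr>) p \<one> \<and>
       (\<forall>\<tau>\<in>carrier (Gal K F).
          class_tau_minus_one K p \<tau> (pth_class K p \<delta>) \<in> pth_class K p ` interm_units K F p s)) \<longleftrightarrow>
      P.holds_I s"
      unfolding P.holds_I_def carrier[symmetric] fixed_units[OF s]
    proof (intro bex_cong refl conj_cong)
      fix \<delta> assume \<delta>: "\<delta> \<in> nonzero K"
      have "interm K F p 0 = F"
        using interm[of 0] F by simp
      then show "pth_class (K\<lparr>carrier := F\<rparr>) p (field_norm K F \<delta>) \<noteq>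
          pth_class (K\<lparr>carrier := F\<rparr>) p \<one> \<longleftrightarrow>
        \<not> (\<exists>f\<in>nonzero K. \<sigma> f = f \<and> orbit_prod (units_group K) \<sigma> (p ^ n) \<delta> = f [^]\<^bsub>units_group K\<^esub> p)"
        using norm_class[of 0 \<delta>] \<delta> norm_K[OF \<delta>] unfolding carrier by simp
      have U: "P.fixed_units s \<subseteq> nonzero K"
        using P.fixed_units_subset[of s] by (simp add: nonzero_def)
      have "orbit_prod K \<sigma> j y \<in> P.fixed_units s" if "y \<in> P.fixed_units s" for y j
        using P.fixed_units_N[OF that, of j] by simp
      then show "(\<forall>\<tau>\<in>carrier (Gal K F).
          class_tau_minus_one K p \<tau> (pth_class K p \<delta>) \<in> pth_class K p ` P.fixed_units s) \<longleftrightarrow>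
        (\<exists>y\<in>P.fixed_units s. \<exists>k\<in>nonzero K.
          \<sigma> \<delta> = \<delta> \<otimes>\<^bsub>units_group K\<^esub> y \<otimes>\<^bsub>units_group K\<^esub> k [^]\<^bsub>units_group K\<^esub> p)"
        using all_tau_minus_one_mem_iff[OF \<delta> U, of p] by (simp add: F pow)
    qed
  qed
  \<comment> \<open>A square root of one other than one is \<open>\<ominus> \<one>\<close>; for
    \<open>n = 1\<close> the hypothesis on \<open>\<ominus> \<one>\<close> thus makes
    \<open>\<xi>\<close> a norm.\<close>
  have exceptional: "n > 1 \<or> P.holds_B None" if "p = 2"
  proof (cases "n > 1")
    case False
    have \<xi>: "\<xi> \<in> carrier K" "\<xi> \<otimes> \<xi> = \<one>" "\<xi> \<noteq> \<one>"
      using P.\<xi>_closed P.\<xi>_pow P.\<xi>_neq_one \<open>p = 2\<close> by (auto simp: pow numeral_2_eq_2)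
    then have "(\<xi> \<ominus> \<one>) \<otimes> (\<xi> \<oplus> \<one>) = \<zero>"
      by algebra
    then have "\<xi> \<oplus> \<one> = \<zero>"
      using \<xi> integral[of "\<xi> \<ominus> \<one>" "\<xi> \<oplus> \<one>"] by simp
    then have "\<xi> = \<ominus> \<one>"
      using \<xi> minus_equality[of \<xi> \<one>] by simp
    then have "\<xi> \<in> field_norm K F ` nonzero K"
      using assms(6)[OF that] False by simp
    then show ?thesis
      using norm_K unfolding P.holds_B_def carrier[symmetric] by auto
  qed simp
  note mins = P.Min_indices[OF exceptional]
  have sets:
    "{s \<in> indices_below n. \<xi> \<in> (field_norm K F ` nonzero K) <#>
       (field_norm (interm_field K F p (n - 1)) F ` interm_units K F p s)} =
      {s \<in> indices_below n. P.holds_A s}"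
    "{s \<in> indices_below n. \<xi> \<in> field_norm K (interm K F p (dot_succ s)) ` nonzero K} =
      {s \<in> indices_below n. P.holds_B s}"
    "{s \<in> indices_below n. \<exists>\<delta>\<in>nonzero K.
       pth_class K p \<delta> \<in> fixed_classes K p (Gal K (interm K F p (dot_succ s))) \<and>
       pth_class (interm_field K F p (dot_succ s)) p
         (field_norm K (interm K F p (dot_succ s)) \<delta>) \<noteq>
       pth_class (interm_field K F p (dot_succ s)) p \<one>} =
      {s \<in> indices_below n. P.holds_C s}"
    using holds_A holds_B holds_C by (blast, blast, (intro Collect_cong conj_cong refl, simp))
  show ?thesis
    unfolding Let_def sets i_inv_def candidates using mins by simp
qed

end
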